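(* Let $(\mathbb{X},d)$ be a complete separable metric space, $\nu$ a nonnegative Radon measure on $\mathbb{X}$ that is finite on bounded sets, and $p\in(1,\infty)$. Let $E:L^p(T^*\mathbb{X})\to\mathbb{R}$ be a continuous convex functional for which there is $C>0$ with $E(\omega)\ge C\int_{\mathbb{X}}|\omega|_*^p\,d\nu$ for all $\omega\in L^p(T^*\mathbb{X})$. Define $\mathcal{F}:L^2(\mathbb{X},\nu)\to[0,+\infty]$ by $\mathcal{F}(u)=E(du)$ if $u\in W^{1,p}(\mathbb{X},d,\nu)$ and $\mathcal{F}(u)=+\infty$ otherwise, and assume that $\mathcal{F}$ is convex and lower semicontinuous on $L^2(\mathbb{X},\nu)$. Let $T>0$, $u_0\in L^2(\mathbb{X},\nu)$, and let $u$ be a weak solution of the Cauchy problem $$-\tfrac{d}{dt}u(t)\in\partial\mathcal{F}(u(t)),\quad t\in[0,T],\qquad u(0)=u_0.$$ Then for any $v\in L^1(0,T;W^{1,p}(\mathbb{X},d,\nu))\cap C([0,T];L^2(\mathbb{X},\nu))$ with $\partial_tv\in L^2(\mathbb{X}\times[0,T],\nu\otimes\mathcal{L}^1)$ we have $$\int_0^T\!\!\int_{\mathbb{X}}\partial_tv\,(v-u)\,d\nu\,dt+\int_0^T\mathcal{F}(v(t))\,dt-\int_0^T\mathcal{F}(u(t))\,dt\ \ge\ \tfrac12\|(v-u)(T)\|_{L^2(\mathbb{X},\nu)}^2-\tfrac12\|v(0)-u_0\|_{L^2(\mathbb{X},\nu)}^2,$$ i.e., $u$ is a variational solution of the Cauchy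 problem.
   Context: Throughout $\frac1p+\frac1{p'}=1$. Sobolev functions. A Borel function $g\ge 0$ is a $p$-weak upper gradient of a Borel function $u:\mathbb{X}\to\mathbb{R}$ if $|u(\gamma(l_\gamma))-u(\gamma(0))|\le\int_\gamma g\,ds$ for all (rectifiable) curves $\gamma:[0,l_\gamma]\to\mathbb{X}$ outside a family $\Gamma$ of zero $p$-modulus, where $\mathrm{Mod}_p(\Gamma)=\inf\{\int_{\mathbb{X}}\rho^p\,d\nu:\rho\ge0 \text{ Borel},\ \int_\gamma\rho\,ds\ge1\ \forall\gamma\in\Gamma\}$. $D^{1,p}(\mathbb{X})$ is the set of Borel $u$ having a $p$-weak upper gradient in $L^p(\mathbb{X},\nu)$; each such $u$ has a $\nu$-a.e. unique minimal $p$-weak upper gradient $|Du|\in L^p(\mathbb{X},\nu)$. $W^{1,p}(\mathbb{X},d,\nu)=D^{1,p}(\mathbb{X})\cap L^p(\mathbb{X},\nu)$ with norm $\|u\|=(\int|u|^p\,d\nu+\int|Du|^p\,d\nu)^{1/p}$ (functions identified $\nu$-a.e. as usual). Cotangent module. $\mathrm{PCM}_p$ is the set of countable families $\{(f_i,A_i)\}_{i\in\mathbb{N}}$ with $(A_i)$ a Borel partition of $\mathbb{X}$, $f_i\in D^{1,p}(\mathbb{X})$ and $\sum_i\int_{A_i}|Df_i|^p\,d\nu<\infty$; $\{(f_i,A_i)\}\sim\{(g_j,B_j)\}$ iff $|D(f_i-g_j)|=0$ $\nu$-a.e. on $A_i\cap B_j$ for all $i,j$. On the quotient (a vector space via common refinements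 of partitions) the pointwise norm is $|\{(f_i,A_i)\}_i|_*=|Df_i|$ $\nu$-a.e. on $A_i$, and the norm is $\|\{(f_i,A_i)\}\|^p=\sum_i\int_{A_i}|Df_i|^p\,d\nu$. $L^p(T^*\mathbb{X})$ is the completion. The multiplication $\chi_B\cdot\{(f_i,A_i)\}$ (restriction to $B$, zero elsewhere) extends to a multiplication by $L^\infty(\mathbb{X},\nu)$, and $|\cdot|_*$ extends to $L^p(T^*\mathbb{X})\to L^p(\mathbb{X},\nu)$ with $|h\cdot\omega|_*=|h||\omega|_*$ and $\||\omega|_*\|_{L^p}=\|\omega\|$. The differential of $f\in D^{1,p}(\mathbb{X})$ is $df=[(f,\mathbb{X})]\in L^p(T^*\mathbb{X})$, so $|df|_*=|Df|$. Tangent module. $L^{p'}(T\mathbb{X})$ is the set of bounded linear maps $X:L^p(T^*\mathbb{X})\to L^1(\mathbb{X},\nu)$, $\omega\mapsto\omega(X)$, that are $L^\infty(\mathbb{X},\nu)$-linear, with pointwise norm $|X|=\operatorname{ess\,sup}\{|\omega(X)|:|\omega|_*\le1\ \nu\text{-a.e.}\}\in L^{p'}(\mathbb{X},\nu)$. Via $\langle\omega,X\rangle=\int_{\mathbb{X}}\omega(X)\,d\nu$ it is identified with the Banach dual of $L^p(T^*\mathbb{X})$. Divergence. $X\in\mathcal{D}^{p',2}(\mathbb{X})$ iff $X\in L^{p'}(T\mathbb{X})$ and there is $f\in L^2(\mathbb{X},\nu)$ with $\int_{\mathbb{X}}fg\,d\nu=-\int_{\mathbb{X}}dg(X)\,d\nu$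 for all $g\in W^{1,p}(\mathbb{X},d,\nu)\cap L^2(\mathbb{X},\nu)$; then $\mathrm{div}(X):=f$. Subdifferentials. For a proper convex $\Phi:V\to(-\infty,\infty]$ on a Banach space $V$, $\partial\Phi(v_0)=\{v^*\in V^*:\Phi(v_0+v)-\Phi(v_0)\ge\langle v,v^*\rangle\ \forall v\in V\}$; $\partial E(\omega)\subset L^{p'}(T\mathbb{X})$, and $\partial\mathcal{F}$ is taken in the Hilbert space $L^2(\mathbb{X},\nu)$. Time-dependent functions. For a Hilbert space $H$, $W^{1,2}(a,b;H)$ is the set of $u\in L^2(a,b;H)$ for which there is $v\in L^2(a,b;H)$ with $u(t)-u(a)=\int_a^tv(s)\,ds$ for all $t\in(a,b)$ (then $u_t=\partial_tu=v$ a.e.), and $u\in W^{1,2}_{\rm loc}(0,T;H)$ iff $u\in W^{1,2}(a,b;H)$ for all $0<a<b<T$. $\mathcal{L}^1$ is Lebesgue measure. Weak solution. $u$ is a weak solution of the Cauchy problem if $u\in C([0,T];L^2(\mathbb{X},\nu))\cap W^{1,2}_{\rm loc}(0,T;L^2(\mathbb{X},\nu))$, $u(0,\cdot)=u_0$, and for almost all $t\in(0,T)$ one has $-u_t(t,\cdot)\in\partial\mathcal{F}(u(t,\cdot))$; in other words, for almost all $t$ one has $u(t)\in W^{1,p}(\mathbb{X},d,\nu)$ and there exists $X(t)\in\mathcal{D}^{p',2}(\mathbb{X})$ with $u_t(t,\cdot)=\mathrm{div}(X(t))$ in $\mathbb{X}$ and $X(t)\in\partial E(du(t))$. *)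

theory Defs
  imports "HOL-Analysis.Analysis"
begin

text \<open>
  \<open>L\<^sup>q(\<nu>)\<close> is represented by its measurable functions; two functions that agree
  \<open>\<nu>\<close>-almost everywhere represent the same element, and all notions below that concern
  elements of \<open>L\<^sup>q\<close> only depend on the a.e. class.
\<close>

definition radon_measure :: "'a::metric_space measure \<Rightarrow> bool" where
  "radon_measure \<nu> \<longleftrightarrow> sets \<nu> = sets borel \<and>
     (\<forall>x. \<exists>U. open U \<and> x \<in> U \<and> emeasure \<nu> U < \<infinity>) \<and>
     (\<forall>A\<in>sets borel. emeasure \<nu> A = (SUP K\<in>{K. compact K \<and> K \<subseteq> A}. emeasure \<nu> K))"

definition finite_on_bounded :: "'a::metric_space measure \<Rightarrow> bool" where
  "finite_on_bounded \<nu> \<longleftrightarrow> (\<forall>B\<in>sets borel. bounded B \<longrightarrow> emeasure \<nu> B < \<infinity>)"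

definition Lp_space :: "'a measure \<Rightarrow> real \<Rightarrow> ('a \<Rightarrow> real) set" where
  "Lp_space \<nu> q = {f \<in> borel_measurable \<nu>. integrable \<nu> (\<lambda>x. \<bar>f x\<bar> powr q)}"

definition Lp_norm :: "'a measure \<Rightarrow> real \<Rightarrow> ('a \<Rightarrow> real) \<Rightarrow> real" where
  "Lp_norm \<nu> q f = (LINT x|\<nu>. \<bar>f x\<bar> powr q) powr (1 / q)"

definition L2_inner :: "'a measure \<Rightarrow> ('a \<Rightarrow> real) \<Rightarrow> ('a \<Rightarrow> real) \<Rightarrow> real" where
  "L2_inner \<nu> f g = (LINT x|\<nu>. f x * g x)"


section \<open>Curves, modulus and weak upper gradients\<close>

definition curve_length :: "(real \<Rightarrow> 'a::metric_space) \<Rightarrow> real \<Rightarrow> real \<Rightarrow> ennreal" where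
  "curve_length \<gamma> a b = (SUP ts\<in>{ts. sorted ts \<and> set ts \<subseteq> {a..b}}.
     \<Sum>i<length ts - 1. ennreal (dist (\<gamma> (ts ! i)) (\<gamma> (ts ! Suc i))))"

text \<open>
  A rectifiable curve is a pair \<open>(l, \<gamma>)\<close> of its length and its arc-length parametrization
  on \<open>[0, l]\<close> (the values of \<open>\<gamma>\<close> elsewhere are irrelevant). Continuity is
  implied, since \<open>\<gamma>\<close> is 1-Lipschitz on \<open>[0, l]\<close>.
\<close>

definition rect_curves :: "(real \<times> (real \<Rightarrow> 'a::metric_space)) set" where
  "rect_curves = {(l, \<gamma>). 0 \<le> l \<and>
     (\<forall>s t. 0 \<le> s \<and> s \<le> t \<and> t \<le> l \<longrightarrow> curve_length \<gamma> s t = ennreal (t - s))}"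

definition line_integral :: "('a \<Rightarrow> ennreal) \<Rightarrow> real \<times> (real \<Rightarrow> 'a) \<Rightarrow> ennreal" where
  "line_integral g c = (\<integral>\<^sup>+ s\<in>{0..fst c}. g (snd c s) \<partial>lborel)"

definition ennpow :: "ennreal \<Rightarrow> real \<Rightarrow> ennreal" where
  "ennpow x p = (if x = \<infinity> then \<infinity> else ennreal (enn2real x powr p))"

definition modulus ::
    "'a::metric_space measure \<Rightarrow> real \<Rightarrow> (real \<times> (real \<Rightarrow> 'a)) set \<Rightarrow> ennreal" where
  "modulus \<nu> p \<Gamma> = (INF \<rho>\<in>{\<rho>. \<rho> \<in> borel_measurable borel \<and> (\<forall>c\<in>\<Gamma>. 1 \<le> line_integral \<rho> c)}.
     \<integral>\<^sup>+ x. ennpow (\<rho> x) p \<partial>\<nu>)"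

definition weak_upper_gradient ::
    "'a::metric_space measure \<Rightarrow> real \<Rightarrow> ('a \<Rightarrow> ennreal) \<Rightarrow> ('a \<Rightarrow> real) \<Rightarrow> bool" where
  "weak_upper_gradient \<nu> p g u \<longleftrightarrow> g \<in> borel_measurable borel \<and>
     (\<exists>\<Gamma>. \<Gamma> \<subseteq> rect_curves \<and> modulus \<nu> p \<Gamma> = 0 \<and>
        (\<forall>(l, \<gamma>) \<in> rect_curves - \<Gamma>. ennreal \<bar>u (\<gamma> l) - u (\<gamma> 0)\<bar> \<le> line_integral g (l, \<gamma>)))"

definition Lp_weak_upper_gradient ::
    "'a::metric_space measure \<Rightarrow> real \<Rightarrow> ('a \<Rightarrow> ennreal) \<Rightarrow> ('a \<Rightarrow> real) \<Rightarrow> bool" where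
  "Lp_weak_upper_gradient \<nu> p g u \<longleftrightarrow>
     weak_upper_gradient \<nu> p g u \<and> (\<integral>\<^sup>+ x. ennpow (g x) p \<partial>\<nu>) < \<infinity>"

definition D1p :: "'a::metric_space measure \<Rightarrow> real \<Rightarrow> ('a \<Rightarrow> real) set" where
  "D1p \<nu> p = {u \<in> borel_measurable borel. \<exists>g. Lp_weak_upper_gradient \<nu> p g u}"

definition min_weak_upper_gradient ::
    "'a::metric_space measure \<Rightarrow> real \<Rightarrow> ('a \<Rightarrow> ennreal) \<Rightarrow> ('a \<Rightarrow> real) \<Rightarrow> bool" where
  "min_weak_upper_gradient \<nu> p g u \<longleftrightarrow> Lp_weak_upper_gradient \<nu> p g u \<and>
     (\<forall>h. Lp_weak_upper_gradient \<nu> p h u \<longrightarrow> (AE x in \<nu>. g x \<le> h x))"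

text \<open>
  \<open>|Du|\<close> for \<open>u \<in> D\<^sup>1\<^sup>,\<^sup>p\<close>. It is finite a.e., being in \<open>L\<^sup>p\<close>, so the conversion to a
  real-valued function only affects a null set.
\<close>

definition min_grad :: "'a::metric_space measure \<Rightarrow> real \<Rightarrow> ('a \<Rightarrow> real) \<Rightarrow> 'a \<Rightarrow> real" where
  "min_grad \<nu> p u x = enn2real ((SOME g. min_weak_upper_gradient \<nu> p g u) x)"

text \<open>
  The Sobolev space, with functions identified a.e.: an a.e. class belongs to it iff it
  contains a function in \<open>D\<^sup>1\<^sup>,\<^sup>p\<close>. Two such representatives have a
  difference whose minimal weak upper gradient vanishes, so the choice made in
  \<open>D1p_rep\<close> is immaterial.
\<close>

definition sobolev :: "'a::metric_space measure \<Rightarrow> real \<Rightarrow> ('a \<Rightarrow> real) set" where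
  "sobolev \<nu> p = {u \<in> Lp_space \<nu> p. \<exists>w\<in>D1p \<nu> p. AE x in \<nu>. w x = u x}"

definition D1p_rep :: "'a::metric_space measure \<Rightarrow> real \<Rightarrow> ('a \<Rightarrow> real) \<Rightarrow> 'a \<Rightarrow> real" where
  "D1p_rep \<nu> p u = (SOME w. w \<in> D1p \<nu> p \<and> (AE x in \<nu>. w x = u x))"

definition sobolev_norm :: "'a::metric_space measure \<Rightarrow> real \<Rightarrow> ('a \<Rightarrow> real) \<Rightarrow> real" where
  "sobolev_norm \<nu> p u =
     ((LINT x|\<nu>. \<bar>u x\<bar> powr p) + (LINT x|\<nu>. min_grad \<nu> p (D1p_rep \<nu> p u) x powr p)) powr (1 / p)"


section \<open>The cotangent module\<close>

type_synonym 'a pcm = "nat \<Rightarrow> ('a \<Rightarrow> real) \<times> 'a set"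

definition pcm_energy :: "'a::metric_space measure \<Rightarrow> real \<Rightarrow> 'a pcm \<Rightarrow> ennreal" where
  "pcm_energy \<nu> p P =
     (\<Sum>i. \<integral>\<^sup>+ x\<in>snd (P i). ennreal (min_grad \<nu> p (fst (P i)) x powr p) \<partial>\<nu>)"

definition PCM :: "'a::metric_space measure \<Rightarrow> real \<Rightarrow> 'a pcm set" where
  "PCM \<nu> p = {P. (\<forall>i. fst (P i) \<in> D1p \<nu> p \<and> snd (P i) \<in> sets borel) \<and>
     disjoint_family (\<lambda>i. snd (P i)) \<and> (\<Union>i. snd (P i)) = UNIV \<and>
     pcm_energy \<nu> p P < \<infinity>}"

definition pcm_norm :: "'a::metric_space measure \<Rightarrow> real \<Rightarrow> 'a pcm \<Rightarrow> real" where
  "pcm_norm \<nu> p P = enn2real (pcm_energy \<nu> p P) powr (1 / p)"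

definition pcm_pointwise_norm ::
    "'a::metric_space measure \<Rightarrow> real \<Rightarrow> 'a pcm \<Rightarrow> 'a \<Rightarrow> real" where
  "pcm_pointwise_norm \<nu> p P x = min_grad \<nu> p (fst (P (THE i. x \<in> snd (P i)))) x"

text \<open>The sum lives on the common refinement of the two partitions.\<close>

definition pcm_add :: "'a pcm \<Rightarrow> 'a pcm \<Rightarrow> 'a pcm" where
  "pcm_add P Q n = (case prod_decode n of (i, j) \<Rightarrow>
     (\<lambda>x. fst (P i) x + fst (Q j) x, snd (P i) \<inter> snd (Q j)))"

definition pcm_scale :: "real \<Rightarrow> 'a pcm \<Rightarrow> 'a pcm" where
  "pcm_scale c P i = (\<lambda>x. c * fst (P i) x, snd (P i))"

definition pcm_dist :: "'a::metric_space measure \<Rightarrow> real \<Rightarrow> 'a pcm \<Rightarrow> 'a pcm \<Rightarrow> real" where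
  "pcm_dist \<nu> p P Q = pcm_norm \<nu> p (pcm_add P (pcm_scale (-1) Q))"

definition pcm_Cauchy :: "'a::metric_space measure \<Rightarrow> real \<Rightarrow> (nat \<Rightarrow> 'a pcm) set" where
  "pcm_Cauchy \<nu> p = {s. (\<forall>n. s n \<in> PCM \<nu> p) \<and>
     (\<forall>\<epsilon>>0. \<exists>N. \<forall>m\<ge>N. \<forall>n\<ge>N. pcm_dist \<nu> p (s m) (s n) < \<epsilon>)}"

definition cot_rel ::
    "'a::metric_space measure \<Rightarrow> real \<Rightarrow> ((nat \<Rightarrow> 'a pcm) \<times> (nat \<Rightarrow> 'a pcm)) set" where
  "cot_rel \<nu> p = {(s, r). s \<in> pcm_Cauchy \<nu> p \<and> r \<in> pcm_Cauchy \<nu> p \<and>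
     (\<lambda>n. pcm_dist \<nu> p (s n) (r n)) \<longlonglongrightarrow> 0}"

text \<open>
  \<open>L\<^sup>p(T\<^sup>*X)\<close>: classes of Cauchy sequences. Two families \<open>(f\<^sub>i, A\<^sub>i)\<close> and \<open>(g\<^sub>j, B\<^sub>j)\<close>
  have \<open>pcm_dist\<close> zero iff \<open>|D(f\<^sub>i - g\<^sub>j)| = 0\<close> a.e. on all \<open>A\<^sub>i \<inter> B\<^sub>j\<close>,
  so this also performs the identification of equivalent families.
\<close>

type_synonym 'a covector_field = "(nat \<Rightarrow> 'a pcm) set"

definition cotangent :: "'a::metric_space measure \<Rightarrow> real \<Rightarrow> 'a covector_field set" where
  "cotangent \<nu> p = pcm_Cauchy \<nu> p // cot_rel \<nu> p"

definition cot_add :: "'a::metric_space measure \<Rightarrow> real \<Rightarrow>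
    'a covector_field \<Rightarrow> 'a covector_field \<Rightarrow> 'a covector_field" where
  "cot_add \<nu> p \<omega> \<eta> = (\<Union>s\<in>\<omega>. \<Union>r\<in>\<eta>. cot_rel \<nu> p `` {\<lambda>n. pcm_add (s n) (r n)})"

definition cot_scale :: "'a::metric_space measure \<Rightarrow> real \<Rightarrow>
    real \<Rightarrow> 'a covector_field \<Rightarrow> 'a covector_field" where
  "cot_scale \<nu> p c \<omega> = (\<Union>s\<in>\<omega>. cot_rel \<nu> p `` {\<lambda>n. pcm_scale c (s n)})"

definition cot_norm :: "'a::metric_space measure \<Rightarrow> real \<Rightarrow> 'a covector_field \<Rightarrow> real" where
  "cot_norm \<nu> p \<omega> = (THE a. \<forall>s\<in>\<omega>. (\<lambda>n. pcm_norm \<nu> p (s n)) \<longlonglongrightarrow> a)"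

text \<open>\<open>|\<omega>|\<^sub>*\<close> is the limit in \<open>L\<^sup>p\<close> of the pointwise norms of an approximating sequence.\<close>

definition cot_pointwise_norm ::
    "'a::metric_space measure \<Rightarrow> real \<Rightarrow> 'a covector_field \<Rightarrow> 'a \<Rightarrow> real" where
  "cot_pointwise_norm \<nu> p \<omega> = (SOME h. h \<in> Lp_space \<nu> p \<and>
     (\<forall>s\<in>\<omega>. (\<lambda>n. \<integral>\<^sup>+ x. ennreal (\<bar>pcm_pointwise_norm \<nu> p (s n) x - h x\<bar> powr p) \<partial>\<nu>)
        \<longlonglongrightarrow> 0))"

text \<open>The family \<open>(f, X), (f, {}), (f, {}), \<dots>\<close> represents \<open>df\<close> for \<open>f \<in> D\<^sup>1\<^sup>,\<^sup>p\<close>.\<close>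

definition differential :: "'a::metric_space measure \<Rightarrow> real \<Rightarrow> ('a \<Rightarrow> real) \<Rightarrow> 'a covector_field"
  where "differential \<nu> p f = cot_rel \<nu> p `` {\<lambda>n i. (f, if i = 0 then UNIV else {})}"

definition cot_continuous ::
    "'a::metric_space measure \<Rightarrow> real \<Rightarrow> ('a covector_field \<Rightarrow> real) \<Rightarrow> bool" where
  "cot_continuous \<nu> p E \<longleftrightarrow> (\<forall>\<omega>\<in>cotangent \<nu> p. \<forall>\<epsilon>>0. \<exists>\<delta>>0. \<forall>\<eta>\<in>cotangent \<nu> p.
     cot_norm \<nu> p (cot_add \<nu> p \<eta> (cot_scale \<nu> p (-1) \<omega>)) < \<delta> \<longrightarrow> \<bar>E \<eta> - E \<omega>\<bar> < \<epsilon>)"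

definition cot_convex ::
    "'a::metric_space measure \<Rightarrow> real \<Rightarrow> ('a covector_field \<Rightarrow> real) \<Rightarrow> bool" where
  "cot_convex \<nu> p E \<longleftrightarrow> (\<forall>\<omega>\<in>cotangent \<nu> p. \<forall>\<eta>\<in>cotangent \<nu> p. \<forall>\<theta>\<in>{0..1}.
     E (cot_add \<nu> p (cot_scale \<nu> p (1 - \<theta>) \<omega>) (cot_scale \<nu> p \<theta> \<eta>))
       \<le> (1 - \<theta>) * E \<omega> + \<theta> * E \<eta>)"


section \<open>Functionals on L2\<close>

definition L2_convex :: "'a measure \<Rightarrow> (('a \<Rightarrow> real) \<Rightarrow> ennreal) \<Rightarrow> bool" where
  "L2_convex \<nu> \<Phi> \<longleftrightarrow> (\<forall>u\<in>Lp_space \<nu> 2. \<forall>v\<in>Lp_space \<nu> 2. \<forall>\<theta>\<in>{0..1}.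
     \<Phi> (\<lambda>x. (1 - \<theta>) * u x + \<theta> * v x) \<le> ennreal (1 - \<theta>) * \<Phi> u + ennreal \<theta> * \<Phi> v)"

definition L2_lsc :: "'a measure \<Rightarrow> (('a \<Rightarrow> real) \<Rightarrow> ennreal) \<Rightarrow> bool" where
  "L2_lsc \<nu> \<Phi> \<longleftrightarrow> (\<forall>u\<in>Lp_space \<nu> 2. \<forall>c<\<Phi> u. \<exists>\<delta>>0. \<forall>w\<in>Lp_space \<nu> 2.
     Lp_norm \<nu> 2 (\<lambda>x. w x - u x) < \<delta> \<longrightarrow> c < \<Phi> w)"

text \<open>The dual of \<open>L\<^sup>2\<close> is identified with \<open>L\<^sup>2\<close> through the inner product.\<close>

definition L2_subdiff ::
    "'a measure \<Rightarrow> (('a \<Rightarrow> real) \<Rightarrow> ennreal) \<Rightarrow> ('a \<Rightarrow> real) \<Rightarrow> ('a \<Rightarrow> real) set" where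
  "L2_subdiff \<nu> \<Phi> u = {w \<in> Lp_space \<nu> 2. \<Phi> u \<noteq> \<infinity> \<and>
     (\<forall>v\<in>Lp_space \<nu> 2. enn2ereal (\<Phi> (\<lambda>x. u x + v x)) - enn2ereal (\<Phi> u) \<ge> ereal (L2_inner \<nu> v w))}"

text \<open>The conversion to \<^typ>\<open>ennreal\<close> truncates negative values of \<open>E\<close>; it is faithful for \<open>E \<ge> 0\<close> on \<open>cotangent\<close>.\<close>

definition grad_energy ::
    "'a::metric_space measure \<Rightarrow> real \<Rightarrow> ('a covector_field \<Rightarrow> real) \<Rightarrow> ('a \<Rightarrow> real) \<Rightarrow> ennreal" where
  "grad_energy \<nu> p E u =
     (if u \<in> sobolev \<nu> p then ennreal (E (differential \<nu> p (D1p_rep \<nu> p u))) else \<infinity>)"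


section \<open>Functions of time\<close>

text \<open>
  Bochner spaces with values in a space \<open>V\<close> of functions on \<open>X\<close> with seminorm \<open>N\<close>;
  the set \<open>S\<close> of times will always be a bounded interval.
\<close>

definition simple_path ::
    "('a \<Rightarrow> real) set \<Rightarrow> real set \<Rightarrow> (real \<Rightarrow> 'a \<Rightarrow> real) \<Rightarrow> bool" where
  "simple_path V S s \<longleftrightarrow> finite (s ` S) \<and> s ` S \<subseteq> V \<and> (\<forall>y. {t\<in>S. s t = y} \<in> sets lebesgue)"

definition strongly_measurable :: "('a \<Rightarrow> real) set \<Rightarrow> (('a \<Rightarrow> real) \<Rightarrow> real) \<Rightarrow>
    real set \<Rightarrow> (real \<Rightarrow> 'a \<Rightarrow> real) \<Rightarrow> bool" where
  "strongly_measurable V N S f \<longleftrightarrow> (\<exists>s. (\<forall>n. simple_path V S (s n)) \<and>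
     (AE t in lebesgue_on S. f t \<in> V \<and> (\<lambda>n. N (\<lambda>x. f t x - s n t x)) \<longlonglongrightarrow> 0))"

definition bochner_Lq :: "real \<Rightarrow> ('a \<Rightarrow> real) set \<Rightarrow> (('a \<Rightarrow> real) \<Rightarrow> real) \<Rightarrow>
    real set \<Rightarrow> (real \<Rightarrow> 'a \<Rightarrow> real) set" where
  "bochner_Lq q V N S = {f. strongly_measurable V N S f \<and>
     (\<integral>\<^sup>+ t. ennreal (N (f t) powr q) \<partial>lebesgue_on S) < \<infinity>}"

abbreviation L2_L2 :: "'a measure \<Rightarrow> real \<Rightarrow> real \<Rightarrow> (real \<Rightarrow> 'a \<Rightarrow> real) set" where
  "L2_L2 \<nu> a b \<equiv> bochner_Lq 2 (Lp_space \<nu> 2) (Lp_norm \<nu> 2) {a<..<b}"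

definition simple_path_integral :: "real set \<Rightarrow> (real \<Rightarrow> 'a \<Rightarrow> real) \<Rightarrow> 'a \<Rightarrow> real" where
  "simple_path_integral S s x = (\<Sum>y\<in>s ` S. measure lebesgue {t\<in>S. s t = y} * y x)"

text \<open>\<open>w\<close> is the Bochner integral of \<open>f\<close> over \<open>S\<close> in the Hilbert space \<open>L\<^sup>2(\<nu>)\<close>.\<close>

definition has_L2_integral ::
    "'a measure \<Rightarrow> (real \<Rightarrow> 'a \<Rightarrow> real) \<Rightarrow> ('a \<Rightarrow> real) \<Rightarrow> real set \<Rightarrow> bool" where
  "has_L2_integral \<nu> f w S \<longleftrightarrow> w \<in> Lp_space \<nu> 2 \<and>
     strongly_measurable (Lp_space \<nu> 2) (Lp_norm \<nu> 2) S f \<and>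
     (\<exists>s. (\<forall>n. simple_path (Lp_space \<nu> 2) S (s n)) \<and>
        (\<lambda>n. \<integral>\<^sup>+ t. ennreal (Lp_norm \<nu> 2 (\<lambda>x. f t x - s n t x)) \<partial>lebesgue_on S) \<longlonglongrightarrow> 0 \<and>
        (\<lambda>n. Lp_norm \<nu> 2 (\<lambda>x. simple_path_integral S (s n) x - w x)) \<longlonglongrightarrow> 0)"

text \<open>\<open>u\<close> belongs to \<open>W\<^sup>1\<^sup>,\<^sup>2(a, b; L\<^sup>2(\<nu>))\<close> and \<open>u'\<close> is its time derivative.\<close>

definition has_time_deriv ::
    "'a measure \<Rightarrow> real \<Rightarrow> real \<Rightarrow> (real \<Rightarrow> 'a \<Rightarrow> real) \<Rightarrow> (real \<Rightarrow> 'a \<Rightarrow> real) \<Rightarrow> bool" where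
  "has_time_deriv \<nu> a b u u' \<longleftrightarrow> u \<in> L2_L2 \<nu> a b \<and> u' \<in> L2_L2 \<nu> a b \<and>
     (\<forall>t\<in>{a<..<b}. has_L2_integral \<nu> u' (\<lambda>x. u t x - u a x) {a<..<t})"

definition L2_continuous_on :: "'a measure \<Rightarrow> real set \<Rightarrow> (real \<Rightarrow> 'a \<Rightarrow> real) \<Rightarrow> bool" where
  "L2_continuous_on \<nu> S u \<longleftrightarrow> (\<forall>t\<in>S. u t \<in> Lp_space \<nu> 2 \<and>
     ((\<lambda>s. Lp_norm \<nu> 2 (\<lambda>x. u s x - u t x)) \<longlongrightarrow> 0) (at t within S))"

text \<open>
  \<open>u'\<close> below is \<open>u\<^sub>t\<close>, which is determined up to null sets of times; its existence on
  all compact subintervals is the membership of \<open>u\<close> in \<open>W\<^sup>1\<^sup>,\<^sup>2\<^sub>l\<^sub>o\<^sub>c\<close>.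
\<close>

definition weak_solution :: "'a measure \<Rightarrow> real \<Rightarrow> (('a \<Rightarrow> real) \<Rightarrow> ennreal) \<Rightarrow>
    ('a \<Rightarrow> real) \<Rightarrow> (real \<Rightarrow> 'a \<Rightarrow> real) \<Rightarrow> bool" where
  "weak_solution \<nu> T \<Phi> u0 u \<longleftrightarrow> L2_continuous_on \<nu> {0..T} u \<and> (AE x in \<nu>. u 0 x = u0 x) \<and>
     (\<exists>u'. (\<forall>a b. 0 < a \<and> a < b \<and> b < T \<longrightarrow> has_time_deriv \<nu> a b u u') \<and>
        (AE t in lebesgue_on {0<..<T}. (\<lambda>x. - u' t x) \<in> L2_subdiff \<nu> \<Phi> (u t)))"

end

theory Submission
  imports Defs
begin

text \<open>
  The theorem is an instance of a fact about the gradient flow of a lower semicontinuous functional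
  \<open>\<Phi>\<close> on \<open>L\<^sup>2(\<nu>)\<close>. For almost every time,
  \<open>-u' \<in> \<partial>\<Phi>(u)\<close> gives \<open>\<Phi>(v) - \<Phi>(u) \<ge> \<langle>-u', v - u\<rangle>\<close>, hence
  \<open>\<langle>v', v - u\<rangle> + \<Phi>(v) - \<Phi>(u) \<ge> \<langle>v' - u', v - u\<rangle>\<close>, and the right-hand side is the derivative of
  \<open>\<parallel>v - u\<parallel>\<^sup>2 / 2\<close>. Integration in time gives the claim. Two points need care.

  First, the chain rule for \<open>\<parallel>v - u\<parallel>\<^sup>2 / 2\<close> must be derived from the definition of the time derivative
  by Bochner integrals (\<open>energy_identity\<close>). The Bochner integrals enter through the scalar integrals of
  \<open>\<langle>w', \<phi>\<rangle>\<close> with fixed \<open>\<phi>\<close> (\<open>has_L2_integral_inner\<close>).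

  Second, \<open>u'\<close> is controlled only on compact subintervals of \<open>(0, T)\<close>, and \<open>\<Phi>(u)\<close> is not known in
  advance to be integrable. The inequality is therefore proved on \<open>(a, b)\<close> as an upper bound for
  \<open>\<integral> \<Phi>(u)\<close> in which \<open>u'\<close> does not occur (\<open>subdiff_interval_inequality\<close>), and the bound is passed to the
  limit \<open>a \<rightarrow> 0\<close>, \<open>b \<rightarrow> T\<close> (\<open>weak_solution_variational_inequality\<close>). With a competitor that is constant
  in time the bound yields integrability of \<open>\<Phi>(u)\<close> (\<open>weak_solution_energy_finite\<close>); with the given
  \<open>v\<close> it is the assertion, unless \<open>\<integral> \<Phi>(v) = \<infinity>\<close>, where the assertion is trivial.
\<close>

section \<open>The space of square integrable functions\<close>

lemma Lp_space_2_iff: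
  "f \<in> Lp_space \<nu> 2 \<longleftrightarrow> f \<in> borel_measurable \<nu> \<and> integrable \<nu> (\<lambda>x. (f x)\<^sup>2)"
  by (simp add: Lp_space_def)

lemma L2_mult_integrable:
  assumes "f \<in> Lp_space \<nu> 2" "g \<in> Lp_space \<nu> 2"
  shows "integrable \<nu> (\<lambda>x. f x * g x)"
proof (rule Bochner_Integration.integrable_bound[where f="\<lambda>x. (f x)\<^sup>2 + (g x)\<^sup>2"])
  show "integrable \<nu> (\<lambda>x. (f x)\<^sup>2 + (g x)\<^sup>2)"
    using assms by (auto simp: Lp_space_2_iff)
  show "(\<lambda>x. f x * g x) \<in> borel_measurable \<nu>"
    using assms by (auto simp: Lp_space_2_iff)
  have "\<bar>f x * g x\<bar> \<le> (f x)\<^sup>2 + (g x)\<^sup>2" for x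
  proof -
    have "0 \<le> (\<bar>f x\<bar> - \<bar>g x\<bar>)\<^sup>2" by simp
    then have "2 * (\<bar>f x\<bar> * \<bar>g x\<bar>) \<le> (f x)\<^sup>2 + (g x)\<^sup>2"
      by (simp add: power2_diff)
    moreover have "0 \<le> \<bar>f x\<bar> * \<bar>g x\<bar>" by simp
    ultimately show ?thesis unfolding abs_mult by linarith
  qed
  then show "AE x in \<nu>. norm (f x * g x) \<le> norm ((f x)\<^sup>2 + (g x)\<^sup>2)" by simp
qed

lemma L2_scale:
  assumes "f \<in> Lp_space \<nu> 2" shows "(\<lambda>x. c * f x) \<in> Lp_space \<nu> 2"
  using assms by (auto simp: Lp_space_2_iff power_mult_distrib)

lemma L2_add:
  assumes "f \<in> Lp_space \<nu> 2" "g \<in> Lp_space \<nu> 2"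
  shows "(\<lambda>x. f x + g x) \<in> Lp_space \<nu> 2"
  using assms L2_mult_integrable[OF assms]
  by (auto simp: Lp_space_2_iff power2_sum mult.assoc intro!: Bochner_Integration.integrable_add)

lemma L2_diff:
  assumes "f \<in> Lp_space \<nu> 2" "g \<in> Lp_space \<nu> 2"
  shows "(\<lambda>x. f x - g x) \<in> Lp_space \<nu> 2"
  using L2_add[OF assms(1) L2_scale[OF assms(2), of "-1"]] by simp

lemma L2_zero: "(\<lambda>x. 0) \<in> Lp_space \<nu> 2"
  by (simp add: Lp_space_2_iff)

lemma L2_inner_commute: "L2_inner \<nu> f g = L2_inner \<nu> g f"
  by (simp add: L2_inner_def mult.commute)

lemma L2_inner_add_left:
  assumes "f \<in> Lp_space \<nu> 2" "g \<in> Lp_space \<nu> 2" "h \<in> Lp_space \<nu> 2"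
  shows "L2_inner \<nu> (\<lambda>x. f x + g x) h = L2_inner \<nu> f h + L2_inner \<nu> g h"
  using assms by (simp add: L2_inner_def distrib_right L2_mult_integrable)

lemma L2_inner_diff_left:
  assumes "f \<in> Lp_space \<nu> 2" "g \<in> Lp_space \<nu> 2" "h \<in> Lp_space \<nu> 2"
  shows "L2_inner \<nu> (\<lambda>x. f x - g x) h = L2_inner \<nu> f h - L2_inner \<nu> g h"
  using assms by (simp add: L2_inner_def left_diff_distrib L2_mult_integrable)

lemma L2_inner_scale_left: "L2_inner \<nu> (\<lambda>x. c * f x) h = c * L2_inner \<nu> f h"
  by (simp add: L2_inner_def mult.assoc)

lemma L2_inner_self_nonneg: "0 \<le> L2_inner \<nu> f f"
  by (simp add: L2_inner_def)

lemma Lp_norm_2_eq_sqrt: "Lp_norm \<nu> 2 f = sqrt (L2_inner \<nu> f f)"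
  using L2_inner_self_nonneg[of \<nu> f]
  by (simp add: Lp_norm_def L2_inner_def power2_eq_square powr_half_sqrt)

lemma Lp_norm_2_power2: "(Lp_norm \<nu> 2 f)\<^sup>2 = L2_inner \<nu> f f"
  by (simp add: Lp_norm_2_eq_sqrt L2_inner_self_nonneg)

lemma Lp_norm_2_nonneg: "0 \<le> Lp_norm \<nu> 2 f"
  by (simp add: Lp_norm_2_eq_sqrt L2_inner_self_nonneg)

text \<open>
  The discriminant argument for \<open>t \<mapsto> \<parallel>f + t g\<parallel>\<^sup>2 \<ge> 0\<close>. The functions are
  representatives, on which \<open>L2_inner\<close> is only semidefinite; hence the separate case \<open>\<parallel>g\<parallel> = 0\<close>.
\<close>

lemma L2_Cauchy_Schwarz:
  assumes f: "f \<in> Lp_space \<nu> 2" and g: "g \<in> Lp_space \<nu> 2"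
  shows "\<bar>L2_inner \<nu> f g\<bar> \<le> Lp_norm \<nu> 2 f * Lp_norm \<nu> 2 g"
proof -
  let ?a = "L2_inner \<nu> f f" and ?b = "L2_inner \<nu> f g" and ?c = "L2_inner \<nu> g g"
  have quad: "0 \<le> ?a + 2 * t * ?b + t\<^sup>2 * ?c" for t
  proof -
    let ?h = "\<lambda>x. f x + t * g x"
    have "0 \<le> L2_inner \<nu> ?h ?h" by (rule L2_inner_self_nonneg)
    also have "L2_inner \<nu> ?h ?h = L2_inner \<nu> f ?h + t * L2_inner \<nu> g ?h"
      using f g by (simp add: L2_inner_add_left L2_scale L2_add L2_inner_scale_left)
    also have "L2_inner \<nu> f ?h = ?a + t * ?b"
      using f g by (subst (1 2 3) L2_inner_commute)
        (simp add: L2_inner_add_left L2_scale L2_add L2_inner_scale_left)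
    also have "L2_inner \<nu> g ?h = ?b + t * ?c"
      using f g by (subst (1 2) L2_inner_commute)
        (simp add: L2_inner_add_left L2_scale L2_add L2_inner_scale_left)
    finally show ?thesis by (simp add: algebra_simps power2_eq_square)
  qed
  have "?b\<^sup>2 \<le> ?a * ?c"
  proof (cases "?c = 0")
    case True
    have "?b = 0"
    proof (rule ccontr)
      assume "?b \<noteq> 0"
      \<comment> \<open>Here the quadratic is affine and takes the value \<open>-1\<close> at this point.\<close>
      then have "2 * (- (?a + 1) / (2 * ?b)) * ?b = - (?a + 1)" by (simp add: field_simps)
      then show False using quad[of "- (?a + 1) / (2 * ?b)"] True by simp
    qed
    then show ?thesis using True by simp
  next
    case False
    then have "0 < ?c" using L2_inner_self_nonneg[of \<nu> g] by linarith
    then show ?thesis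
      using quad[of "- ?b / ?c"] by (simp add: field_simps power2_eq_square)
  qed
  then have "sqrt (?b\<^sup>2) \<le> sqrt (?a * ?c)" by (rule real_sqrt_le_mono)
  then show ?thesis by (simp add: Lp_norm_2_eq_sqrt real_sqrt_mult)
qed

lemma Lp_norm_2_triangle:
  assumes f: "f \<in> Lp_space \<nu> 2" and g: "g \<in> Lp_space \<nu> 2"
  shows "Lp_norm \<nu> 2 (\<lambda>x. f x + g x) \<le> Lp_norm \<nu> 2 f + Lp_norm \<nu> 2 g"
proof (rule power2_le_imp_le)
  have "(Lp_norm \<nu> 2 (\<lambda>x. f x + g x))\<^sup>2
      = L2_inner \<nu> f f + 2 * L2_inner \<nu> f g + L2_inner \<nu> g g"
    using f g L2_inner_commute[of \<nu> f "\<lambda>x. f x + g x"] L2_inner_commute[of \<nu> g "\<lambda>x. f x + g x"]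
    by (simp add: Lp_norm_2_power2 L2_inner_add_left L2_add L2_inner_commute[of \<nu> g f])
  also have "\<dots> \<le> (Lp_norm \<nu> 2 f + Lp_norm \<nu> 2 g)\<^sup>2"
    using L2_Cauchy_Schwarz[OF f g] by (simp add: power2_sum Lp_norm_2_power2)
  finally show "(Lp_norm \<nu> 2 (\<lambda>x. f x + g x))\<^sup>2 \<le> (Lp_norm \<nu> 2 f + Lp_norm \<nu> 2 g)\<^sup>2" .
  show "0 \<le> Lp_norm \<nu> 2 f + Lp_norm \<nu> 2 g"
    by (simp add: Lp_norm_2_nonneg)
qed

lemma Lp_norm_2_minus_commute:
  "Lp_norm \<nu> 2 (\<lambda>x. f x - g x) = Lp_norm \<nu> 2 (\<lambda>x. g x - f x)"
  by (simp add: Lp_norm_def abs_minus_commute)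

lemma Lp_norm_2_diff_triangle:
  assumes "f \<in> Lp_space \<nu> 2" "g \<in> Lp_space \<nu> 2" "h \<in> Lp_space \<nu> 2"
  shows "Lp_norm \<nu> 2 (\<lambda>x. f x - h x) \<le> Lp_norm \<nu> 2 (\<lambda>x. f x - g x) + Lp_norm \<nu> 2 (\<lambda>x. g x - h x)"
  using Lp_norm_2_triangle[of "\<lambda>x. f x - g x" \<nu> "\<lambda>x. g x - h x"] assms by (simp add: L2_diff)

lemma Lp_norm_2_diff_le:
  assumes "f \<in> Lp_space \<nu> 2" "g \<in> Lp_space \<nu> 2"
  shows "Lp_norm \<nu> 2 (\<lambda>x. f x - g x) \<le> Lp_norm \<nu> 2 f + Lp_norm \<nu> 2 g"
  using Lp_norm_2_diff_triangle[OF assms(1) L2_zero assms(2)] Lp_norm_2_minus_commute[of \<nu> "\<lambda>_. 0" g]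
  by simp

lemma Lp_norm_2_reverse_triangle:
  assumes f: "f \<in> Lp_space \<nu> 2" and g: "g \<in> Lp_space \<nu> 2"
  shows "\<bar>Lp_norm \<nu> 2 f - Lp_norm \<nu> 2 g\<bar> \<le> Lp_norm \<nu> 2 (\<lambda>x. f x - g x)"
proof -
  have "Lp_norm \<nu> 2 f \<le> Lp_norm \<nu> 2 (\<lambda>x. f x - g x) + Lp_norm \<nu> 2 g"
    using Lp_norm_2_triangle[OF L2_diff[OF f g] g] by simp
  moreover have "Lp_norm \<nu> 2 g \<le> Lp_norm \<nu> 2 (\<lambda>x. f x - g x) + Lp_norm \<nu> 2 f"
    using Lp_norm_2_triangle[OF L2_diff[OF g f] f] Lp_norm_2_minus_commute[of \<nu> f g] by simp
  ultimately show ?thesis by linarith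
qed

lemma Lp_norm_2_scale: "Lp_norm \<nu> 2 (\<lambda>x. c * f x) = \<bar>c\<bar> * Lp_norm \<nu> 2 f"
proof -
  have "L2_inner \<nu> (\<lambda>x. c * f x) (\<lambda>x. c * f x) = c\<^sup>2 * L2_inner \<nu> f f"
    by (simp add: L2_inner_def power2_eq_square mult.assoc mult.left_commute)
  then show ?thesis by (simp add: Lp_norm_2_eq_sqrt real_sqrt_mult)
qed

lemma L2_inner_diff_right:
  assumes "f \<in> Lp_space \<nu> 2" "g \<in> Lp_space \<nu> 2" "h \<in> Lp_space \<nu> 2"
  shows "L2_inner \<nu> h (\<lambda>x. f x - g x) = L2_inner \<nu> h f - L2_inner \<nu> h g"
  using L2_inner_diff_left[OF assms]
    L2_inner_commute[of \<nu> "\<lambda>x. f x - g x" h] L2_inner_commute[of \<nu> f h] L2_inner_commute[of \<nu> g h] by simp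

lemma Lp_norm_2_zero [simp]: "Lp_norm \<nu> 2 (\<lambda>_. 0) = 0"
  by (simp add: Lp_norm_def)

text \<open>
  Needed at the initial time, where a weak solution agrees with \<open>u0\<close> only almost everywhere.
\<close>

lemma Lp_norm_2_cong_AE:
  assumes "f \<in> borel_measurable \<nu>" "g \<in> borel_measurable \<nu>" "AE x in \<nu>. f x = g x"
  shows "Lp_norm \<nu> 2 f = Lp_norm \<nu> 2 g"
proof -
  have "(LINT x|\<nu>. \<bar>f x\<bar> powr 2) = (LINT x|\<nu>. \<bar>g x\<bar> powr 2)"
    using assms by (intro integral_cong_AE) auto
  then show ?thesis by (simp add: Lp_norm_def)
qed

section \<open>Integrals over time intervals\<close>

lemma integrable_lebesgue_on_subset:
  fixes f :: "real \<Rightarrow> real"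
  assumes "integrable (lebesgue_on S) f" "R \<subseteq> S" "R \<in> sets lebesgue" "S \<in> sets lebesgue"
  shows "integrable (lebesgue_on R) f"
proof -
  have "set_integrable lebesgue S f" using assms by (simp add: set_integrable_def integrable_restrict_space)
  then have "set_integrable lebesgue R f" using assms by (meson set_integrable_subset)
  then show ?thesis using assms by (simp add: set_integrable_def integrable_restrict_space)
qed

lemma AE_lebesgue_on_iff:
  "S \<in> sets lebesgue \<Longrightarrow> (AE t in lebesgue_on S. P t) \<longleftrightarrow> (AE t in lebesgue. t \<in> S \<longrightarrow> P t)"
  by (simp add: AE_restrict_space_iff)

lemma AE_lebesgue_on_subset:
  assumes "AE t in lebesgue_on S. P t" "R \<subseteq> S" "R \<in> sets lebesgue" "S \<in> sets lebesgue"
  shows "AE t in lebesgue_on R. P t"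
  using assms by (auto simp: AE_lebesgue_on_iff)

lemma AE_not_endpoints: "AE t in lebesgue. t \<noteq> (a::real) \<and> t \<noteq> b"
proof -
  have "AE t in lebesgue. t \<notin> {a, b}"
    by (rule AE_not_in) (simp add: null_sets_def emeasure_lborel_countable)
  then show ?thesis by simp
qed

text \<open>
  The data of the problem live on open time intervals, continuity and the assertion on closed
  ones; this lemma and the next one pass between them.
\<close>

lemma nn_integral_Ioo_eq_Icc:
  fixes f :: "real \<Rightarrow> ennreal"
  shows "(\<integral>\<^sup>+ t. f t \<partial>lebesgue_on {a<..<b}) = (\<integral>\<^sup>+ t. f t \<partial>lebesgue_on {a..b})"
proof -
  have "AE t in lebesgue. f t * indicator {a<..<b} t = f t * indicator {a..b} t"
    using AE_not_endpoints[of a b] by eventually_elim (auto simp: indicator_def)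
  then show ?thesis by (simp add: nn_integral_restrict_space nn_integral_cong_AE)
qed

lemma integral_Ioo_eq_Icc:
  fixes f :: "real \<Rightarrow> real"
  assumes "integrable (lebesgue_on {a<..<b}) f"
  shows "integrable (lebesgue_on {a..b}) f"
    and "(LINT t|lebesgue_on {a<..<b}. f t) = (LINT t|lebesgue_on {a..b}. f t)"
proof -
  have i: "integrable lebesgue (\<lambda>t. indicator {a<..<b} t *\<^sub>R f t)"
    using assms by (simp add: integrable_restrict_space)
  have ae: "AE t in lebesgue. indicator {a<..<b} t *\<^sub>R f t = indicator {a..b} t *\<^sub>R f t"
    using AE_not_endpoints[of a b] by eventually_elim (auto simp: indicator_def)
  have m: "(\<lambda>t. indicator {a..b} t *\<^sub>R f t) \<in> borel_measurable lebesgue"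
    by (rule borel_measurable_AE[OF _ ae]) (use i in auto)
  show "integrable (lebesgue_on {a..b}) f"
    using Bochner_Integration.integrable_cong_AE_imp[OF i m] ae by (simp add: integrable_restrict_space)
  show "(LINT t|lebesgue_on {a<..<b}. f t) = (LINT t|lebesgue_on {a..b}. f t)"
    using integral_cong_AE[OF _ m ae] i by (simp add: integral_restrict_space)
qed

text \<open>
  On open intervals additivity hides the removal of the point \<open>c\<close>. In this form it makes the local
  estimate in the proof of the energy identity additive over adjacent intervals.
\<close>

lemma integral_Ioo_combine:
  fixes f :: "real \<Rightarrow> real"
  assumes f: "integrable (lebesgue_on {a<..<b}) f" and "a \<le> c" "c \<le> b"
  shows "(LINT t|lebesgue_on {a<..<b}. f t)
    = (LINT t|lebesgue_on {a<..<c}. f t) + (LINT t|lebesgue_on {c<..<b}. f t)"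
proof -
  have "integrable (lebesgue_on {a<..<c}) f" "integrable (lebesgue_on {c<..<b}) f"
    by (rule integrable_lebesgue_on_subset[OF f]; use assms in auto)+
  then show ?thesis
    using integral_combine[OF integral_Ioo_eq_Icc(1)[OF f] assms(2,3)] f
    by (simp add: integral_Ioo_eq_Icc(2))
qed

section \<open>Strongly measurable paths\<close>

text \<open>
  This makes the closure properties of simple functions available for paths whose values are
  functions on \<open>X\<close>: any pointwise-in-time operation on simple paths is again simple, whatever
  its target type.
\<close>

lemma simple_path_iff:
  assumes "S \<in> sets lebesgue"
  shows "simple_path V S s \<longleftrightarrow> simple_function (lebesgue_on S) s \<and> s ` S \<subseteq> V"
proof -
  have eq: "s -` {y} \<inter> S = {t \<in> S. s t = y}" for y by auto
  have "(\<forall>y\<in>s ` S. {t \<in> S. s t = y} \<in> sets lebesgue) \<longleftrightarrow> (\<forall>y. {t \<in> S. s t = y} \<in> sets lebesgue)"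
  proof safe
    fix y assume *: "\<forall>y\<in>s ` S. {t \<in> S. s t = y} \<in> sets lebesgue"
    show "{t \<in> S. s t = y} \<in> sets lebesgue"
    proof (cases "y \<in> s ` S")
      case False
      then have "{t \<in> S. s t = y} = {}" by auto
      then show ?thesis by (simp only: sets.empty_sets)
    qed (use * in blast)
  qed auto
  then show ?thesis
    using assms by (auto simp: simple_path_def simple_function_def eq sets_restrict_space_iff)
qed

lemma simple_path_subset:
  assumes "simple_path V S s" "R \<subseteq> S" "R \<in> sets lebesgue"
  shows "simple_path V R s"
  unfolding simple_path_def
proof (intro conjI allI)
  show "finite (s ` R)" "s ` R \<subseteq> V"
    using assms by (auto simp: simple_path_def intro: finite_subset[OF image_mono])
  fix y
  have "{t \<in> R. s t = y} = R \<inter> {t \<in> S. s t = y}" using assms(2) by auto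
  then show "{t \<in> R. s t = y} \<in> sets lebesgue"
    using assms by (auto simp: simple_path_def)
qed

lemma strongly_measurable_subset:
  assumes "strongly_measurable V N S f" "R \<subseteq> S" "R \<in> sets lebesgue" "S \<in> sets lebesgue"
  shows "strongly_measurable V N R f"
proof -
  obtain s where s: "\<And>n. simple_path V S (s n)"
    "AE t in lebesgue_on S. f t \<in> V \<and> (\<lambda>n. N (\<lambda>x. f t x - s n t x)) \<longlonglongrightarrow> 0"
    using assms(1) unfolding strongly_measurable_def by blast
  show ?thesis
    unfolding strongly_measurable_def
    using simple_path_subset[OF s(1) assms(2,3)] AE_lebesgue_on_subset[OF s(2) assms(2-4)]
    by (intro exI[of _ s] conjI allI)
qed

lemma strongly_measurable_AE_mem:
  "strongly_measurable V N S f \<Longrightarrow> AE t in lebesgue_on S. f t \<in> V"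
  unfolding strongly_measurable_def by (auto elim!: eventually_mono)

lemma strongly_measurable_const:
  assumes "y \<in> Lp_space \<nu> 2" "S \<in> sets lebesgue"
  shows "strongly_measurable (Lp_space \<nu> 2) (Lp_norm \<nu> 2) S (\<lambda>_. y)"
  unfolding strongly_measurable_def
  by (rule exI[of _ "\<lambda>_ _. y"]) (use assms in \<open>auto simp: simple_path_iff Lp_norm_def\<close>)

lemma strongly_measurable_diff:
  assumes f: "strongly_measurable (Lp_space \<nu> 2) (Lp_norm \<nu> 2) S f"
    and g: "strongly_measurable (Lp_space \<nu> 2) (Lp_norm \<nu> 2) S g" and S: "S \<in> sets lebesgue"
  shows "strongly_measurable (Lp_space \<nu> 2) (Lp_norm \<nu> 2) S (\<lambda>t x. f t x - g t x)"
proof -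
  obtain r where r: "\<And>n. simple_path (Lp_space \<nu> 2) S (r n)"
    "AE t in lebesgue_on S. f t \<in> Lp_space \<nu> 2 \<and> (\<lambda>n. Lp_norm \<nu> 2 (\<lambda>x. f t x - r n t x)) \<longlonglongrightarrow> 0"
    using f unfolding strongly_measurable_def by blast
  obtain s where s: "\<And>n. simple_path (Lp_space \<nu> 2) S (s n)"
    "AE t in lebesgue_on S. g t \<in> Lp_space \<nu> 2 \<and> (\<lambda>n. Lp_norm \<nu> 2 (\<lambda>x. g t x - s n t x)) \<longlonglongrightarrow> 0"
    using g unfolding strongly_measurable_def by blast
  have "simple_path (Lp_space \<nu> 2) S (\<lambda>t x. r n t x - s n t x)" for n
    using r(1)[of n] s(1)[of n] S simple_function_compose2[of "lebesgue_on S" "r n" "s n" "\<lambda>y z x. y x - z x"]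
    by (auto simp: simple_path_iff intro!: L2_diff)
  moreover have "AE t in lebesgue_on S. (\<lambda>x. f t x - g t x) \<in> Lp_space \<nu> 2 \<and>
      (\<lambda>n. Lp_norm \<nu> 2 (\<lambda>x. (f t x - g t x) - (r n t x - s n t x))) \<longlonglongrightarrow> 0"
    using r(2) s(2) AE_space
  proof eventually_elim
    case (elim t)
    have tS: "t \<in> S" using elim(3) by simp
    have mem: "r n t \<in> Lp_space \<nu> 2" "s n t \<in> Lp_space \<nu> 2" for n
      using r(1)[of n] s(1)[of n] tS by (auto simp: simple_path_def)
    have "(\<lambda>n. Lp_norm \<nu> 2 (\<lambda>x. f t x - r n t x) + Lp_norm \<nu> 2 (\<lambda>x. g t x - s n t x)) \<longlonglongrightarrow> 0 + 0"
      using elim by (intro tendsto_add) auto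
    then have lim: "(\<lambda>n. Lp_norm \<nu> 2 (\<lambda>x. f t x - r n t x) + Lp_norm \<nu> 2 (\<lambda>x. g t x - s n t x)) \<longlonglongrightarrow> 0"
      by simp
    have "Lp_norm \<nu> 2 (\<lambda>x. (f t x - g t x) - (r n t x - s n t x))
        \<le> Lp_norm \<nu> 2 (\<lambda>x. f t x - r n t x) + Lp_norm \<nu> 2 (\<lambda>x. g t x - s n t x)" for n
      using Lp_norm_2_diff_le[of "\<lambda>x. f t x - r n t x" \<nu> "\<lambda>x. g t x - s n t x"] elim mem[of n]
      by (simp add: L2_diff algebra_simps)
    then have "(\<lambda>n. Lp_norm \<nu> 2 (\<lambda>x. (f t x - g t x) - (r n t x - s n t x))) \<longlonglongrightarrow> 0"
      by (intro tendsto_sandwich[OF _ _ tendsto_const lim]) (auto simp: Lp_norm_2_nonneg)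
    then show ?case using elim by (auto intro: L2_diff)
  qed
  ultimately show ?thesis
    unfolding strongly_measurable_def by (intro exI[of _ "\<lambda>n t x. r n t x - s n t x"]) auto
qed

text \<open>
  Completeness of Lebesgue measure allows the convergence to fail on a null set of times.
\<close>

lemma borel_measurable_lebesgue_on_AE_limit:
  fixes h :: "nat \<Rightarrow> real \<Rightarrow> real"
  assumes S: "S \<in> sets lebesgue" and h: "\<And>n. h n \<in> borel_measurable (lebesgue_on S)"
    and lim: "AE t in lebesgue_on S. (\<lambda>n. h n t) \<longlonglongrightarrow> H t"
  shows "H \<in> borel_measurable (lebesgue_on S)"
proof -
  let ?k = "\<lambda>n t. if t \<in> S then h n t else 0"
  have k: "?k n \<in> borel_measurable lebesgue" for n
    using h[of n] S by (simp add: borel_measurable_if)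
  have "(\<lambda>t. lim (\<lambda>n. ?k n t)) \<in> borel_measurable lebesgue"
    by (rule borel_measurable_lim_metric[OF k])
  moreover have "AE t in lebesgue. lim (\<lambda>n. ?k n t) = (if t \<in> S then H t else 0)"
    using lim unfolding AE_lebesgue_on_iff[OF S]
    by eventually_elim (auto intro: limI)
  ultimately have "(\<lambda>t. if t \<in> S then H t else 0) \<in> borel_measurable lebesgue"
    by (rule borel_measurable_AE)
  then show ?thesis using S by (simp add: borel_measurable_if)
qed

lemma L2_inner_tendsto:
  assumes "f \<in> Lp_space \<nu> 2" "g \<in> Lp_space \<nu> 2"
    "\<And>n. r n \<in> Lp_space \<nu> 2" "\<And>n. s n \<in> Lp_space \<nu> 2"
    and r: "(\<lambda>n. Lp_norm \<nu> 2 (\<lambda>x. f x - r n x)) \<longlonglongrightarrow> 0"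
    and s: "(\<lambda>n. Lp_norm \<nu> 2 (\<lambda>x. g x - s n x)) \<longlonglongrightarrow> 0"
  shows "(\<lambda>n. L2_inner \<nu> (r n) (s n)) \<longlonglongrightarrow> L2_inner \<nu> f g"
proof -
  have bound: "\<bar>L2_inner \<nu> f g - L2_inner \<nu> (r n) (s n)\<bar>
    \<le> Lp_norm \<nu> 2 (\<lambda>x. f x - r n x) * Lp_norm \<nu> 2 g
      + (Lp_norm \<nu> 2 f + Lp_norm \<nu> 2 (\<lambda>x. f x - r n x)) * Lp_norm \<nu> 2 (\<lambda>x. g x - s n x)" for n
  proof -
    have "L2_inner \<nu> f g - L2_inner \<nu> (r n) (s n)
      = L2_inner \<nu> (\<lambda>x. f x - r n x) g + L2_inner \<nu> (\<lambda>x. g x - s n x) (r n)"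
      using assms(1,2) assms(3,4)[of n] L2_inner_commute[of \<nu> "r n" g] L2_inner_commute[of \<nu> "r n" "s n"]
      by (simp add: L2_inner_diff_left)
    moreover have "\<bar>L2_inner \<nu> (\<lambda>x. f x - r n x) g\<bar> \<le> Lp_norm \<nu> 2 (\<lambda>x. f x - r n x) * Lp_norm \<nu> 2 g"
      using assms(1-4) by (intro L2_Cauchy_Schwarz L2_diff)
    moreover have "\<bar>L2_inner \<nu> (\<lambda>x. g x - s n x) (r n)\<bar> \<le> Lp_norm \<nu> 2 (\<lambda>x. g x - s n x) * Lp_norm \<nu> 2 (r n)"
      using assms(1-4) by (intro L2_Cauchy_Schwarz L2_diff)
    moreover have "Lp_norm \<nu> 2 (r n) \<le> Lp_norm \<nu> 2 f + Lp_norm \<nu> 2 (\<lambda>x. f x - r n x)"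
      using Lp_norm_2_reverse_triangle[OF assms(1) assms(3)[of n]] by linarith
    then have "Lp_norm \<nu> 2 (\<lambda>x. g x - s n x) * Lp_norm \<nu> 2 (r n)
      \<le> Lp_norm \<nu> 2 (\<lambda>x. g x - s n x) * (Lp_norm \<nu> 2 f + Lp_norm \<nu> 2 (\<lambda>x. f x - r n x))"
      by (intro mult_left_mono Lp_norm_2_nonneg)
    ultimately show ?thesis by (simp add: mult.commute)
  qed
  have "(\<lambda>n. Lp_norm \<nu> 2 (\<lambda>x. f x - r n x) * Lp_norm \<nu> 2 g
      + (Lp_norm \<nu> 2 f + Lp_norm \<nu> 2 (\<lambda>x. f x - r n x)) * Lp_norm \<nu> 2 (\<lambda>x. g x - s n x))
    \<longlonglongrightarrow> 0 * Lp_norm \<nu> 2 g + (Lp_norm \<nu> 2 f + 0) * 0"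
    by (intro tendsto_intros r s)
  then have lim0: "(\<lambda>n. Lp_norm \<nu> 2 (\<lambda>x. f x - r n x) * Lp_norm \<nu> 2 g
      + (Lp_norm \<nu> 2 f + Lp_norm \<nu> 2 (\<lambda>x. f x - r n x)) * Lp_norm \<nu> 2 (\<lambda>x. g x - s n x)) \<longlonglongrightarrow> 0"
    by simp
  have "(\<lambda>n. L2_inner \<nu> f g - L2_inner \<nu> (r n) (s n)) \<longlonglongrightarrow> 0"
    by (rule Lim_null_comparison[OF _ lim0]) (simp add: bound)
  then show ?thesis
    using tendsto_diff[OF tendsto_const[of "L2_inner \<nu> f g"]] by fastforce
qed

text \<open>
  Joint continuity of the inner product turns approximating simple paths into approximating
  real-valued simple functions.
\<close>

lemma L2_inner_measurable:
  assumes f: "strongly_measurable (Lp_space \<nu> 2) (Lp_norm \<nu> 2) S f"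
    and g: "strongly_measurable (Lp_space \<nu> 2) (Lp_norm \<nu> 2) S g" and S: "S \<in> sets lebesgue"
  shows "(\<lambda>t. L2_inner \<nu> (f t) (g t)) \<in> borel_measurable (lebesgue_on S)"
proof -
  obtain r where r: "\<And>n. simple_path (Lp_space \<nu> 2) S (r n)"
    "AE t in lebesgue_on S. f t \<in> Lp_space \<nu> 2 \<and> (\<lambda>n. Lp_norm \<nu> 2 (\<lambda>x. f t x - r n t x)) \<longlonglongrightarrow> 0"
    using f unfolding strongly_measurable_def by blast
  obtain s where s: "\<And>n. simple_path (Lp_space \<nu> 2) S (s n)"
    "AE t in lebesgue_on S. g t \<in> Lp_space \<nu> 2 \<and> (\<lambda>n. Lp_norm \<nu> 2 (\<lambda>x. g t x - s n t x)) \<longlonglongrightarrow> 0"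
    using g unfolding strongly_measurable_def by blast
  show ?thesis
  proof (rule borel_measurable_lebesgue_on_AE_limit[OF S])
    show "(\<lambda>t. L2_inner \<nu> (r n t) (s n t)) \<in> borel_measurable (lebesgue_on S)" for n
      using simple_function_compose2[of "lebesgue_on S" "r n" "s n" "L2_inner \<nu>"] r(1)[of n] s(1)[of n]
      by (intro borel_measurable_simple_function) (simp add: simple_path_iff[OF S])
    show "AE t in lebesgue_on S. (\<lambda>n. L2_inner \<nu> (r n t) (s n t)) \<longlonglongrightarrow> L2_inner \<nu> (f t) (g t)"
      using r(2) s(2) AE_space
    proof eventually_elim
      case (elim t)
      have "r n t \<in> Lp_space \<nu> 2" "s n t \<in> Lp_space \<nu> 2" for n
        using r(1)[of n] s(1)[of n] elim(3) by (auto simp: simple_path_def)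
      then show ?case using elim by (intro L2_inner_tendsto) auto
    qed
  qed
qed

lemma Lp_norm_2_measurable:
  assumes "strongly_measurable (Lp_space \<nu> 2) (Lp_norm \<nu> 2) S f" "S \<in> sets lebesgue"
  shows "(\<lambda>t. Lp_norm \<nu> 2 (f t)) \<in> borel_measurable (lebesgue_on S)"
  unfolding Lp_norm_2_eq_sqrt using L2_inner_measurable[OF assms(1,1,2)] by measurable

lemma simple_path_strongly_measurable:
  assumes "simple_path (Lp_space \<nu> 2) S s" "S \<in> sets lebesgue"
  shows "strongly_measurable (Lp_space \<nu> 2) (Lp_norm \<nu> 2) S s"
  unfolding strongly_measurable_def
proof (intro exI[of _ "\<lambda>_. s"] conjI allI)
  have "s t \<in> Lp_space \<nu> 2" if "t \<in> S" for t using assms(1) that by (auto simp: simple_path_def)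
  then show "AE t in lebesgue_on S. s t \<in> Lp_space \<nu> 2 \<and> (\<lambda>n. Lp_norm \<nu> 2 (\<lambda>x. s t x - s t x)) \<longlonglongrightarrow> 0"
    by (intro AE_I2) (simp add: Lp_norm_def)
qed (rule assms(1))

section \<open>Bochner integrals tested against a fixed function\<close>

lemma L2_linear_combination:
  assumes "finite Y" "Y \<subseteq> Lp_space \<nu> 2" "\<phi> \<in> Lp_space \<nu> 2"
  shows "(\<lambda>x. \<Sum>y\<in>Y. c y * y x) \<in> Lp_space \<nu> 2"
    and "L2_inner \<nu> (\<lambda>x. \<Sum>y\<in>Y. c y * y x) \<phi> = (\<Sum>y\<in>Y. c y * L2_inner \<nu> y \<phi>)"
proof -
  have "(\<lambda>x. \<Sum>y\<in>Y. c y * y x) \<in> Lp_space \<nu> 2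
    \<and> L2_inner \<nu> (\<lambda>x. \<Sum>y\<in>Y. c y * y x) \<phi> = (\<Sum>y\<in>Y. c y * L2_inner \<nu> y \<phi>)"
    using assms(1,2)
  proof (induction Y)
    case empty
    then show ?case by (simp add: L2_zero L2_inner_def)
  next
    case (insert z Y)
    then have "z \<in> Lp_space \<nu> 2" and IH: "(\<lambda>x. \<Sum>y\<in>Y. c y * y x) \<in> Lp_space \<nu> 2"
      "L2_inner \<nu> (\<lambda>x. \<Sum>y\<in>Y. c y * y x) \<phi> = (\<Sum>y\<in>Y. c y * L2_inner \<nu> y \<phi>)" by auto
    then show ?case
      using insert(1,2) assms(3)
      by (simp add: L2_add L2_scale L2_inner_add_left L2_inner_scale_left)
  qed
  then show "(\<lambda>x. \<Sum>y\<in>Y. c y * y x) \<in> Lp_space \<nu> 2"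
    and "L2_inner \<nu> (\<lambda>x. \<Sum>y\<in>Y. c y * y x) \<phi> = (\<Sum>y\<in>Y. c y * L2_inner \<nu> y \<phi>)" by auto
qed

text \<open>
  Pairing with \<open>\<phi>\<close> is a bounded linear functional, so it commutes with the Bochner integral: it does
  so on simple paths by linearity, and the Cauchy--Schwarz inequality carries
  both limits of the definition over to the real-valued integrals.
\<close>

lemma has_L2_integral_inner:
  assumes I: "has_L2_integral \<nu> f w S" and S: "S \<in> sets lebesgue" "emeasure lebesgue S < \<infinity>"
    and \<phi>: "\<phi> \<in> Lp_space \<nu> 2"
  shows "has_bochner_integral (lebesgue_on S) (\<lambda>t. L2_inner \<nu> (f t) \<phi>) (L2_inner \<nu> w \<phi>)"
proof -
  let ?M = "lebesgue_on S"
  from I obtain s where w: "w \<in> Lp_space \<nu> 2"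
    and f: "strongly_measurable (Lp_space \<nu> 2) (Lp_norm \<nu> 2) S f"
    and s: "\<And>n. simple_path (Lp_space \<nu> 2) S (s n)"
    and fs: "(\<lambda>n. \<integral>\<^sup>+ t. ennreal (Lp_norm \<nu> 2 (\<lambda>x. f t x - s n t x)) \<partial>?M) \<longlonglongrightarrow> 0"
    and ws: "(\<lambda>n. Lp_norm \<nu> 2 (\<lambda>x. simple_path_integral S (s n) x - w x)) \<longlonglongrightarrow> 0"
    unfolding has_L2_integral_def by blast
  have sf: "simple_function ?M (s n)" and sV: "s n ` S \<subseteq> Lp_space \<nu> 2" for n
    using s[of n] S(1) by (auto simp: simple_path_iff)
  have fin: "emeasure ?M A \<noteq> \<infinity>" for A
  proof -
    have "emeasure ?M A \<le> emeasure ?M (space ?M)" by (rule emeasure_space)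
    also have "\<dots> < \<infinity>" using S by (simp add: emeasure_restrict_space)
    finally show ?thesis by simp
  qed
  have sbi: "Bochner_Integration.simple_bochner_integrable ?M (\<lambda>t. L2_inner \<nu> (s n t) \<phi>)" for n
    by (intro simple_bochner_integrable.intros fin simple_function_compose1[OF sf])
  show ?thesis
  proof (rule has_bochner_integral.intros)
    show "(\<lambda>t. L2_inner \<nu> (f t) \<phi>) \<in> borel_measurable ?M"
      by (rule L2_inner_measurable[OF f strongly_measurable_const[OF \<phi> S(1)] S(1)])
    show "Bochner_Integration.simple_bochner_integrable ?M (\<lambda>t. L2_inner \<nu> (s n t) \<phi>)" for n by (rule sbi)
    have le: "(\<integral>\<^sup>+ t. ennreal (norm (L2_inner \<nu> (f t) \<phi> - L2_inner \<nu> (s n t) \<phi>)) \<partial>?M)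
        \<le> ennreal (Lp_norm \<nu> 2 \<phi>) * (\<integral>\<^sup>+ t. ennreal (Lp_norm \<nu> 2 (\<lambda>x. f t x - s n t x)) \<partial>?M)" for n
    proof -
      have "AE t in ?M. ennreal (norm (L2_inner \<nu> (f t) \<phi> - L2_inner \<nu> (s n t) \<phi>))
          \<le> ennreal (Lp_norm \<nu> 2 \<phi>) * ennreal (Lp_norm \<nu> 2 (\<lambda>x. f t x - s n t x))"
        using strongly_measurable_AE_mem[OF f] AE_space
      proof eventually_elim
        case (elim t)
        then have "s n t \<in> Lp_space \<nu> 2" using sV[of n] by auto
        then have "\<bar>L2_inner \<nu> (f t) \<phi> - L2_inner \<nu> (s n t) \<phi>\<bar>
            \<le> Lp_norm \<nu> 2 (\<lambda>x. f t x - s n t x) * Lp_norm \<nu> 2 \<phi>"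
          using L2_Cauchy_Schwarz[of "\<lambda>x. f t x - s n t x" \<nu> \<phi>] elim \<phi>
          by (simp add: L2_inner_diff_left L2_diff)
        then show ?case
          by (simp add: Lp_norm_2_nonneg mult.commute ennreal_mult[symmetric])
      qed
      then have "(\<integral>\<^sup>+ t. ennreal (norm (L2_inner \<nu> (f t) \<phi> - L2_inner \<nu> (s n t) \<phi>)) \<partial>?M)
        \<le> (\<integral>\<^sup>+ t. ennreal (Lp_norm \<nu> 2 \<phi>) * ennreal (Lp_norm \<nu> 2 (\<lambda>x. f t x - s n t x)) \<partial>?M)"
        by (rule nn_integral_mono_AE)
      also have "\<dots> = ennreal (Lp_norm \<nu> 2 \<phi>) * (\<integral>\<^sup>+ t. ennreal (Lp_norm \<nu> 2 (\<lambda>x. f t x - s n t x)) \<partial>?M)"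
        using Lp_norm_2_measurable[OF strongly_measurable_diff[OF f
            simple_path_strongly_measurable[OF s S(1)] S(1)] S(1)]
        by (intro nn_integral_cmult) auto
      finally show ?thesis .
    qed
    have "(\<lambda>n. ennreal (Lp_norm \<nu> 2 \<phi>) * (\<integral>\<^sup>+ t. ennreal (Lp_norm \<nu> 2 (\<lambda>x. f t x - s n t x)) \<partial>?M))
        \<longlonglongrightarrow> ennreal (Lp_norm \<nu> 2 \<phi>) * 0"
      by (intro ennreal_tendsto_cmult fs) simp
    then have lim0: "(\<lambda>n. ennreal (Lp_norm \<nu> 2 \<phi>) * (\<integral>\<^sup>+ t. ennreal (Lp_norm \<nu> 2 (\<lambda>x. f t x - s n t x)) \<partial>?M))
        \<longlonglongrightarrow> 0" by simp
    show "(\<lambda>n. \<integral>\<^sup>+ t. ennreal (norm (L2_inner \<nu> (f t) \<phi> - L2_inner \<nu> (s n t) \<phi>)) \<partial>?M) \<longlonglongrightarrow> 0"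
      by (rule tendsto_sandwich[OF _ _ tendsto_const lim0]) (auto simp del: real_norm_def intro!: always_eventually le)
    have eq: "Bochner_Integration.simple_bochner_integral ?M (\<lambda>t. L2_inner \<nu> (s n t) \<phi>)
        = L2_inner \<nu> (simple_path_integral S (s n)) \<phi>" for n
    proof -
      have "Bochner_Integration.simple_bochner_integral ?M (\<lambda>t. L2_inner \<nu> (s n t) \<phi>)
        = (\<Sum>y\<in>s n ` space ?M. measure ?M {t \<in> space ?M. s n t = y} *\<^sub>R L2_inner \<nu> y \<phi>)"
        by (rule simple_bochner_integral_partition[OF sbi sf]) auto
      also have "\<dots> = (\<Sum>y\<in>s n ` S. measure lebesgue {t \<in> S. s n t = y} * L2_inner \<nu> y \<phi>)"
        using S(1) by (simp add: measure_restrict_space subset_iff)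
      also have "\<dots> = L2_inner \<nu> (simple_path_integral S (s n)) \<phi>"
        unfolding simple_path_integral_def
        using s[of n] \<phi> by (intro L2_linear_combination(2)[symmetric]) (auto simp: simple_path_def)
      finally show ?thesis .
    qed
    have "simple_path_integral S (s n) \<in> Lp_space \<nu> 2" for n
      unfolding simple_path_integral_def
      using s[of n] \<phi> by (intro L2_linear_combination(1)) (auto simp: simple_path_def)
    then have "(\<lambda>n. L2_inner \<nu> (simple_path_integral S (s n)) \<phi>) \<longlonglongrightarrow> L2_inner \<nu> w \<phi>"
      using w \<phi> ws Lp_norm_2_minus_commute[of \<nu> w]
      by (intro L2_inner_tendsto) (simp_all only: Lp_norm_2_zero diff_self tendsto_const)
    then show "(\<lambda>n. Bochner_Integration.simple_bochner_integral ?M (\<lambda>t. L2_inner \<nu> (s n t) \<phi>)) \<longlonglongrightarrow> L2_inner \<nu> w \<phi>"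
      by (simp add: eq)
  qed
qed

lemma L2_L2_norm_integrable:
  assumes "f \<in> L2_L2 \<nu> a b"
  shows "integrable (lebesgue_on {a<..<b}) (\<lambda>t. Lp_norm \<nu> 2 (f t))"
proof -
  let ?M = "lebesgue_on {a<..<b}"
  interpret finite_measure ?M
    by standard (cases "a \<le> b"; simp add: emeasure_restrict_space)
  have sm: "strongly_measurable (Lp_space \<nu> 2) (Lp_norm \<nu> 2) {a<..<b} f"
    and fin: "(\<integral>\<^sup>+ t. ennreal ((Lp_norm \<nu> 2 (f t))\<^sup>2) \<partial>?M) < \<infinity>"
    using assms by (auto simp: bochner_Lq_def Lp_norm_2_nonneg)
  have m: "(\<lambda>t. Lp_norm \<nu> 2 (f t)) \<in> borel_measurable ?M"
    by (rule Lp_norm_2_measurable[OF sm]) simp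
  have sq: "integrable ?M (\<lambda>t. (Lp_norm \<nu> 2 (f t))\<^sup>2)"
    using m fin by (intro integrableI_bounded) auto
  show ?thesis
  proof (rule Bochner_Integration.integrable_bound[OF _ m])
    show "integrable ?M (\<lambda>t. 1 + (Lp_norm \<nu> 2 (f t))\<^sup>2)" using sq by simp
    have "\<bar>y\<bar> \<le> 1 + y\<^sup>2" for y :: real
    proof -
      have "0 \<le> (\<bar>y\<bar> - 1)\<^sup>2" by simp
      then show ?thesis by (simp add: power2_diff)
    qed
    then show "AE t in ?M. norm (Lp_norm \<nu> 2 (f t)) \<le> norm (1 + (Lp_norm \<nu> 2 (f t))\<^sup>2)" by simp
  qed
qed

section \<open>Continuous paths\<close>

lemma L2_continuous_on_subset:
  "L2_continuous_on \<nu> S w \<Longrightarrow> R \<subseteq> S \<Longrightarrow> L2_continuous_on \<nu> R w"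
  unfolding L2_continuous_on_def by (auto intro: tendsto_within_subset)

lemma L2_continuous_on_diff:
  assumes "L2_continuous_on \<nu> S v" "L2_continuous_on \<nu> S u"
  shows "L2_continuous_on \<nu> S (\<lambda>t x. v t x - u t x)"
  unfolding L2_continuous_on_def
proof (intro ballI conjI)
  fix t assume t: "t \<in> S"
  have mem: "v s \<in> Lp_space \<nu> 2" "u s \<in> Lp_space \<nu> 2" if "s \<in> S" for s
    using assms that by (auto simp: L2_continuous_on_def)
  then show "(\<lambda>x. v t x - u t x) \<in> Lp_space \<nu> 2" using t by (auto intro: L2_diff)
  have le: "Lp_norm \<nu> 2 (\<lambda>x. (v s x - u s x) - (v t x - u t x))
      \<le> Lp_norm \<nu> 2 (\<lambda>x. v s x - v t x) + Lp_norm \<nu> 2 (\<lambda>x. u s x - u t x)" if "s \<in> S" for s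
    using Lp_norm_2_diff_le[of "\<lambda>x. v s x - v t x" \<nu> "\<lambda>x. u s x - u t x"] mem[OF that] mem[OF t]
    by (simp add: L2_diff algebra_simps)
  have "((\<lambda>s. Lp_norm \<nu> 2 (\<lambda>x. v s x - v t x) + Lp_norm \<nu> 2 (\<lambda>x. u s x - u t x)) \<longlongrightarrow> 0 + 0)
      (at t within S)"
    using assms t by (intro tendsto_add) (auto simp: L2_continuous_on_def)
  then have lim: "((\<lambda>s. Lp_norm \<nu> 2 (\<lambda>x. v s x - v t x) + Lp_norm \<nu> 2 (\<lambda>x. u s x - u t x)) \<longlongrightarrow> 0)
      (at t within S)" by simp
  show "((\<lambda>s. Lp_norm \<nu> 2 (\<lambda>x. (v s x - u s x) - (v t x - u t x))) \<longlongrightarrow> 0) (at t within S)"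
  proof (rule tendsto_sandwich[OF _ _ tendsto_const lim])
    show "\<forall>\<^sub>F s in at t within S. Lp_norm \<nu> 2 (\<lambda>x. (v s x - u s x) - (v t x - u t x))
      \<le> Lp_norm \<nu> 2 (\<lambda>x. v s x - v t x) + Lp_norm \<nu> 2 (\<lambda>x. u s x - u t x)"
      unfolding eventually_at_filter by (intro always_eventually allI impI le)
  qed (simp add: Lp_norm_2_nonneg)
qed

lemma L2_continuous_on_LIMSEQ:
  assumes w: "L2_continuous_on \<nu> S w" and "t \<in> S" "\<And>n. x n \<in> S" "x \<longlonglongrightarrow> t"
  shows "(\<lambda>n. Lp_norm \<nu> 2 (\<lambda>y. w (x n) y - w t y)) \<longlonglongrightarrow> 0"
proof -
  have 0: "Lp_norm \<nu> 2 (\<lambda>y. w t y - w t y) = 0" by simp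
  have "continuous (at t within S) (\<lambda>s. Lp_norm \<nu> 2 (\<lambda>y. w s y - w t y))"
    using w \<open>t \<in> S\<close> unfolding continuous_within 0 by (simp add: L2_continuous_on_def)
  from continuous_within_tendsto_compose'[OF this assms(3,4)] show ?thesis by simp
qed

lemma L2_continuous_on_norm:
  assumes "L2_continuous_on \<nu> S w"
  shows "continuous_on S (\<lambda>t. Lp_norm \<nu> 2 (w t))"
  unfolding continuous_on
proof
  fix t assume t: "t \<in> S"
  have lim: "((\<lambda>s. Lp_norm \<nu> 2 (\<lambda>x. w s x - w t x)) \<longlongrightarrow> 0) (at t within S)"
    using assms t by (simp add: L2_continuous_on_def)
  have "\<forall>\<^sub>F s in at t within S. norm (Lp_norm \<nu> 2 (w s) - Lp_norm \<nu> 2 (w t))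
      \<le> Lp_norm \<nu> 2 (\<lambda>x. w s x - w t x)"
    using assms t by (auto simp: eventually_at_filter L2_continuous_on_def intro!: always_eventually Lp_norm_2_reverse_triangle)
  from Lim_null_comparison[OF this lim]
  show "((\<lambda>s. Lp_norm \<nu> 2 (w s)) \<longlongrightarrow> Lp_norm \<nu> 2 (w t)) (at t within S)"
    by (simp add: LIM_zero_iff)
qed

text \<open>
  The approximating simple paths sample \<open>w\<close> at the grid points \<open>\<tau> n t\<close> just before \<open>t\<close>. Rounding
  down to multiples of \<open>1 / (n + 1)\<close> measured from \<open>a\<close> keeps them inside \<open>{a..b}\<close>, where \<open>w\<close> is
  continuous.
\<close>

lemma L2_continuous_on_strongly_measurable:
  assumes w: "L2_continuous_on \<nu> {a..b} w"
  shows "strongly_measurable (Lp_space \<nu> 2) (Lp_norm \<nu> 2) {a<..<b} w"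
proof -
  let ?S = "{a<..<b}"
  define q where "q n t = \<lfloor>real (Suc n) * (t - a)\<rfloor>" for n t
  define \<tau> where "\<tau> n t = a + of_int (q n t) / real (Suc n)" for n t
  have q: "of_int (q n t) \<le> real (Suc n) * (t - a)" "real (Suc n) * (t - a) < of_int (q n t) + 1" for n t
    by (simp_all add: q_def)
  have \<tau>_le: "\<tau> n t \<le> t" and \<tau>_ge: "t - 1 / real (Suc n) \<le> \<tau> n t" for n t
  proof -
    have "of_int (q n t) / real (Suc n) \<le> t - a" "t - a < (of_int (q n t) + 1) / real (Suc n)"
      using q[of n t] by (simp_all add: pos_less_divide_eq pos_divide_le_eq mult.commute)
    then show "\<tau> n t \<le> t" "t - 1 / real (Suc n) \<le> \<tau> n t"
      by (simp_all add: \<tau>_def add_divide_distrib)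
  qed
  have \<tau>_in: "\<tau> n t \<in> {a..b}" if "t \<in> ?S" for n t
  proof -
    have "0 \<le> q n t" using that by (simp add: q_def)
    then show ?thesis using \<tau>_le[of n t] that by (simp add: \<tau>_def)
  qed
  have simple_q: "simple_function (lebesgue_on ?S) (q n)" for n
    unfolding simple_function_def
  proof (intro conjI ballI)
    have "q n ` space (lebesgue_on ?S) \<subseteq> {0..\<lfloor>real (Suc n) * (b - a)\<rfloor>}"
      by (auto simp: q_def intro!: floor_mono mult_left_mono)
    then show "finite (q n ` space (lebesgue_on ?S))" by (rule finite_subset) simp
    have "q n \<in> measurable borel (count_space UNIV)" unfolding q_def by measurable
    then have "q n \<in> measurable (lebesgue_on ?S) (count_space UNIV)"
      by (intro measurable_restrict_space1 measurable_completion) simp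
    then show "q n -` {k} \<inter> space (lebesgue_on ?S) \<in> sets (lebesgue_on ?S)" for k
      by (rule measurable_sets) simp
  qed
  show ?thesis
    unfolding strongly_measurable_def
  proof (intro exI[of _ "\<lambda>n t. w (\<tau> n t)"] conjI allI)
    show "simple_path (Lp_space \<nu> 2) ?S (\<lambda>t. w (\<tau> n t))" for n
    proof -
      have "simple_function (lebesgue_on ?S) (\<lambda>t. w (\<tau> n t))"
        using simple_function_compose1[OF simple_q, of "\<lambda>k. w (a + of_int k / real (Suc n))" n]
        unfolding \<tau>_def .
      then show ?thesis
        using \<tau>_in w by (auto simp: simple_path_iff L2_continuous_on_def)
    qed
    have "w t \<in> Lp_space \<nu> 2 \<and> (\<lambda>n. Lp_norm \<nu> 2 (\<lambda>x. w t x - w (\<tau> n t) x)) \<longlonglongrightarrow> 0" if t: "t \<in> ?S" for t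
    proof -
      have "(\<lambda>n. t - 1 / real (Suc n)) \<longlonglongrightarrow> t - 0"
        by (intro tendsto_intros LIMSEQ_Suc lim_1_over_n)
      then have lim: "(\<lambda>n. t - 1 / real (Suc n)) \<longlonglongrightarrow> t" by simp
      have "(\<lambda>n. \<tau> n t) \<longlonglongrightarrow> t"
        by (rule tendsto_sandwich[OF _ _ lim tendsto_const]) (use \<tau>_le \<tau>_ge in auto)
      then show ?thesis
        using L2_continuous_on_LIMSEQ[OF w _ \<tau>_in[OF t]] w t
        by (simp add: Lp_norm_2_minus_commute[of \<nu> "w t"] L2_continuous_on_def)
    qed
    then show "AE t in lebesgue_on ?S. w t \<in> Lp_space \<nu> 2
        \<and> (\<lambda>n. Lp_norm \<nu> 2 (\<lambda>x. w t x - w (\<tau> n t) x)) \<longlonglongrightarrow> 0"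
      by (intro AE_I2) simp
  qed
qed

lemma L2_inner_integrable:
  assumes f: "strongly_measurable (Lp_space \<nu> 2) (Lp_norm \<nu> 2) {a<..<b} f"
    and fi: "integrable (lebesgue_on {a<..<b}) (\<lambda>t. Lp_norm \<nu> 2 (f t))"
    and g: "L2_continuous_on \<nu> {a..b} g"
  shows "integrable (lebesgue_on {a<..<b}) (\<lambda>t. L2_inner \<nu> (f t) (g t))"
proof -
  have "bounded ((\<lambda>t. Lp_norm \<nu> 2 (g t)) ` {a..b})"
    by (intro compact_imp_bounded compact_continuous_image L2_continuous_on_norm[OF g]) simp
  then obtain K where "\<forall>y \<in> (\<lambda>t. Lp_norm \<nu> 2 (g t)) ` {a..b}. norm y \<le> K"
    unfolding bounded_iff by blast
  then have K: "\<And>t. t \<in> {a..b} \<Longrightarrow> \<bar>Lp_norm \<nu> 2 (g t)\<bar> \<le> K" by auto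
  show ?thesis
  proof (rule Bochner_Integration.integrable_bound[where f="\<lambda>t. K * Lp_norm \<nu> 2 (f t)"])
    show "integrable (lebesgue_on {a<..<b}) (\<lambda>t. K * Lp_norm \<nu> 2 (f t))" using fi by simp
    show "(\<lambda>t. L2_inner \<nu> (f t) (g t)) \<in> borel_measurable (lebesgue_on {a<..<b})"
      by (intro L2_inner_measurable f L2_continuous_on_strongly_measurable g) simp
    show "AE t in lebesgue_on {a<..<b}. norm (L2_inner \<nu> (f t) (g t)) \<le> norm (K * Lp_norm \<nu> 2 (f t))"
      using strongly_measurable_AE_mem[OF f] AE_space
    proof eventually_elim
      case (elim t)
      then have t: "t \<in> {a..b}" by simp
      have "\<bar>L2_inner \<nu> (f t) (g t)\<bar> \<le> Lp_norm \<nu> 2 (f t) * Lp_norm \<nu> 2 (g t)"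
        using elim t g by (intro L2_Cauchy_Schwarz) (auto simp: L2_continuous_on_def)
      also have "\<dots> \<le> Lp_norm \<nu> 2 (f t) * K"
        using K[OF t] by (intro mult_left_mono Lp_norm_2_nonneg) simp
      finally show ?case by (simp add: mult.commute)
    qed
  qed
qed

section \<open>The energy identity\<close>

text \<open>
  The chain rule \<open>d/dt (\<parallel>w\<parallel>\<^sup>2 / 2) = \<langle>w', w\<rangle>\<close> in integrated form, for a derivative that is known only
  weakly. With \<open>\<psi> = (w(t) + w(s)) / 2\<close>, the identity
  \<open>\<parallel>w(t)\<parallel>\<^sup>2 / 2 - \<parallel>w(s)\<parallel>\<^sup>2 / 2 = \<langle>w(t) - w(s), \<psi>\<rangle> = \<integral> \<langle>w'(r), \<psi>\<rangle> dr\<close> over \<open>(s, t)\<close> is exact. Replacing \<open>\<psi>\<close>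
  by \<open>w(r)\<close> costs at most \<open>\<epsilon> \<integral> \<parallel>w'\<parallel>\<close> once \<open>w\<close> oscillates by less than \<open>\<epsilon>\<close> on \<open>[s, t]\<close>. Such an
  error bound is additive over adjacent intervals, so Bolzano's bisection principle extends it from
  short intervals to \<open>[a, b]\<close>.
\<close>

lemma energy_identity:
  assumes "a \<le> b" and w: "L2_continuous_on \<nu> {a..b} w"
    and w': "strongly_measurable (Lp_space \<nu> 2) (Lp_norm \<nu> 2) {a<..<b} w'"
    and w'i: "integrable (lebesgue_on {a<..<b}) (\<lambda>t. Lp_norm \<nu> 2 (w' t))"
    and weak: "\<And>s t \<phi>. a \<le> s \<Longrightarrow> s < t \<Longrightarrow> t \<le> b \<Longrightarrow> \<phi> \<in> Lp_space \<nu> 2 \<Longrightarrow>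
      has_bochner_integral (lebesgue_on {s<..<t}) (\<lambda>r. L2_inner \<nu> (w' r) \<phi>)
        (L2_inner \<nu> (\<lambda>x. w t x - w s x) \<phi>)"
  shows "(LINT t|lebesgue_on {a<..<b}. L2_inner \<nu> (w' t) (w t))
    = 1 / 2 * (Lp_norm \<nu> 2 (w b))\<^sup>2 - 1 / 2 * (Lp_norm \<nu> 2 (w a))\<^sup>2"
proof -
  let ?I = "\<lambda>s t f. (LINT r|lebesgue_on {s<..<t}. f r) :: real"
  let ?H = "\<lambda>r. L2_inner \<nu> (w' r) (w r)" and ?N = "\<lambda>r. Lp_norm \<nu> 2 (w' r)"
  let ?E = "\<lambda>t. 1 / 2 * (Lp_norm \<nu> 2 (w t))\<^sup>2"
  have H: "integrable (lebesgue_on {a<..<b}) ?H" by (rule L2_inner_integrable[OF w' w'i w])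
  have mem: "w t \<in> Lp_space \<nu> 2" if "t \<in> {a..b}" for t
    using w that by (simp add: L2_continuous_on_def)
  have sub: "integrable (lebesgue_on {s<..<t}) f"
    if "integrable (lebesgue_on {a<..<b}) f" "a \<le> s" "t \<le> b" for s t and f :: "real \<Rightarrow> real"
    by (rule integrable_lebesgue_on_subset[OF that(1)]) (use that in auto)
  have main: "\<bar>?E b - ?E a - ?I a b ?H\<bar> \<le> \<epsilon> * ?I a b ?N" if \<epsilon>: "0 < \<epsilon>" for \<epsilon>
  proof -
    let ?P = "\<lambda>s t. a \<le> s \<and> s \<le> t \<and> t \<le> b \<longrightarrow> \<bar>?E t - ?E s - ?I s t ?H\<bar> \<le> \<epsilon> * ?I s t ?N"
    have "?P a b"
    proof (rule Bolzano[where P="?P", OF \<open>a \<le> b\<close>])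
      fix s r t
      assume trans: "?P s r" "?P r t" "s \<le> r" "r \<le> t"
      show "?P s t"
      proof
        assume st: "a \<le> s \<and> s \<le> t \<and> t \<le> b"
        have "?I s t ?H = ?I s r ?H + ?I r t ?H" "?I s t ?N = ?I s r ?N + ?I r t ?N"
          using st trans(3,4) by (intro integral_Ioo_combine sub[OF H] sub[OF w'i]; simp)+
        then show "\<bar>?E t - ?E s - ?I s t ?H\<bar> \<le> \<epsilon> * ?I s t ?N"
          using trans st by (simp add: distrib_left abs_le_iff)
      qed
    next
      fix y assume local: "a \<le> y" "y \<le> b"
      have "\<forall>\<^sub>F r in at y within {a..b}. Lp_norm \<nu> 2 (\<lambda>x. w r x - w y x) < \<epsilon> / 2"
        using w local \<epsilon> by (intro order_tendstoD(2)[where y=0]) (auto simp: L2_continuous_on_def)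
      then obtain d where d: "0 < d"
        "\<And>r. r \<in> {a..b} \<Longrightarrow> r \<noteq> y \<Longrightarrow> dist r y < d \<Longrightarrow> Lp_norm \<nu> 2 (\<lambda>x. w r x - w y x) < \<epsilon> / 2"
        unfolding eventually_at by blast
      have near: "Lp_norm \<nu> 2 (\<lambda>x. w r x - w y x) \<le> \<epsilon> / 2" if "r \<in> {a..b}" "dist r y < d" for r
        using d(2)[OF that(1) _ that(2)] \<epsilon> by (cases "r = y") (auto simp: Lp_norm_def)
      have "?P s t" if "s \<le> y \<and> y \<le> t \<and> t - s < d" for s t
      proof
        assume st: "a \<le> s \<and> s \<le> t \<and> t \<le> b"
        show "\<bar>?E t - ?E s - ?I s t ?H\<bar> \<le> \<epsilon> * ?I s t ?N"
        proof (cases "s < t")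
          case False
          then have "s = t" using st by simp
          then show ?thesis by simp
        next
          case True
          define \<psi> where "\<psi> x = 1 / 2 * (w t x + w s x)" for x
          have ws: "w s \<in> Lp_space \<nu> 2" and wt: "w t \<in> Lp_space \<nu> 2" using st mem by auto
          have \<psi>: "\<psi> \<in> Lp_space \<nu> 2"
            unfolding \<psi>_def by (intro L2_scale L2_add ws wt)
          have E: "?E t - ?E s = L2_inner \<nu> (\<lambda>x. w t x - w s x) \<psi>"
          proof -
            have "L2_inner \<nu> h \<psi> = 1 / 2 * (L2_inner \<nu> h (w t) + L2_inner \<nu> h (w s))"
              if "h \<in> Lp_space \<nu> 2" for h
              using L2_inner_scale_left[of \<nu> "1 / 2" "\<lambda>x. w t x + w s x" h] L2_inner_add_left[OF wt ws that]
              L2_inner_commute[of \<nu> h \<psi>] L2_inner_commute[of \<nu> h "w t"] L2_inner_commute[of \<nu> h "w s"]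
              unfolding \<psi>_def by simp
            from this[OF L2_diff[OF wt ws]] show ?thesis
              using ws wt L2_inner_commute[of \<nu> "w s" "w t"]
              by (simp add: L2_inner_diff_left Lp_norm_2_power2)
          qed
          have b: "has_bochner_integral (lebesgue_on {s<..<t}) (\<lambda>r. L2_inner \<nu> (w' r) \<psi>) (?E t - ?E s)"
            unfolding E using st True by (intro weak \<psi>) auto
          have i\<psi>: "integrable (lebesgue_on {s<..<t}) (\<lambda>r. L2_inner \<nu> (w' r) \<psi>)"
            and e\<psi>: "?I s t (\<lambda>r. L2_inner \<nu> (w' r) \<psi>) = ?E t - ?E s"
            using b by (auto simp: has_bochner_integral_iff)
          have iH: "integrable (lebesgue_on {s<..<t}) ?H" and iN: "integrable (lebesgue_on {s<..<t}) ?N"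
            using st by (auto intro: sub[OF H] sub[OF w'i])
          have "?E t - ?E s - ?I s t ?H = ?I s t (\<lambda>r. L2_inner \<nu> (w' r) \<psi> - ?H r)"
            using i\<psi> iH e\<psi> by simp
          also have "\<bar>\<dots>\<bar> \<le> ?I s t (\<lambda>r. \<bar>L2_inner \<nu> (w' r) \<psi> - ?H r\<bar>)"
            by (rule integral_abs_bound)
          also have "\<dots> \<le> ?I s t (\<lambda>r. \<epsilon> * ?N r)"
          proof (rule integral_mono_AE)
            show "integrable (lebesgue_on {s<..<t}) (\<lambda>r. \<bar>L2_inner \<nu> (w' r) \<psi> - ?H r\<bar>)"
              using i\<psi> iH by simp
            show "integrable (lebesgue_on {s<..<t}) (\<lambda>r. \<epsilon> * ?N r)" using iN by simp
            have "AE r in lebesgue_on {s<..<t}. w' r \<in> Lp_space \<nu> 2"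
              by (rule AE_lebesgue_on_subset[OF strongly_measurable_AE_mem[OF w']]) (use st in auto)
            then show "AE r in lebesgue_on {s<..<t}. \<bar>L2_inner \<nu> (w' r) \<psi> - ?H r\<bar> \<le> \<epsilon> * ?N r"
              using AE_space
            proof eventually_elim
              case (elim r)
              have r: "r \<in> {s<..<t}" using elim by simp
              then have wr: "w r \<in> Lp_space \<nu> 2" using st by (intro mem) auto
              have wy: "w y \<in> Lp_space \<nu> 2" using local by (intro mem) auto
              have close: "Lp_norm \<nu> 2 (\<lambda>x. w z x - w r x) \<le> \<epsilon>" if z: "z \<in> {s, t}" for z
              proof -
                have "w z \<in> Lp_space \<nu> 2" using z ws wt by auto
                then have "Lp_norm \<nu> 2 (\<lambda>x. w z x - w r x)
                    \<le> Lp_norm \<nu> 2 (\<lambda>x. w z x - w y x) + Lp_norm \<nu> 2 (\<lambda>x. w r x - w y x)"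
                  using Lp_norm_2_diff_triangle[OF _ wy wr, of "w z"] Lp_norm_2_minus_commute[of \<nu> "w r" "w y"]
                  by simp
                also have "\<dots> \<le> \<epsilon> / 2 + \<epsilon> / 2"
                  using z r st \<open>s \<le> y \<and> y \<le> t \<and> t - s < d\<close>
                  by (intro add_mono near) (auto simp: dist_real_def)
                finally show ?thesis by simp
              qed
              have "Lp_norm \<nu> 2 (\<lambda>x. \<psi> x - w r x)
                = Lp_norm \<nu> 2 (\<lambda>x. 1 / 2 * (w t x - w r x) + 1 / 2 * (w s x - w r x))"
                unfolding \<psi>_def by (rule arg_cong[where f="Lp_norm \<nu> 2"]) (auto simp: algebra_simps)
              also have "\<dots> \<le> 1 / 2 * Lp_norm \<nu> 2 (\<lambda>x. w t x - w r x) + 1 / 2 * Lp_norm \<nu> 2 (\<lambda>x. w s x - w r x)"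
                using Lp_norm_2_triangle[OF L2_scale[OF L2_diff[OF wt wr], of "1 / 2"]
                    L2_scale[OF L2_diff[OF ws wr], of "1 / 2"]]
                unfolding Lp_norm_2_scale by simp
              also have "\<dots> \<le> \<epsilon>" using close[of s] close[of t] by simp
              finally have \<psi>r: "Lp_norm \<nu> 2 (\<lambda>x. \<psi> x - w r x) \<le> \<epsilon>" .
              have "\<bar>L2_inner \<nu> (w' r) \<psi> - ?H r\<bar> = \<bar>L2_inner \<nu> (w' r) (\<lambda>x. \<psi> x - w r x)\<bar>"
                using elim \<psi> wr by (simp add: L2_inner_diff_right)
              also have "\<dots> \<le> ?N r * Lp_norm \<nu> 2 (\<lambda>x. \<psi> x - w r x)"
                using elim \<psi> wr by (intro L2_Cauchy_Schwarz L2_diff)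
              also have "\<dots> \<le> ?N r * \<epsilon>" by (intro mult_left_mono \<psi>r Lp_norm_2_nonneg)
              finally show ?case by (simp add: mult.commute)
            qed
          qed
          finally show ?thesis by simp
        qed
      qed
      then show "\<exists>d>0. \<forall>s t. s \<le> y \<and> y \<le> t \<and> t - s < d \<longrightarrow> ?P s t" using d(1) by blast
    qed
    then show ?thesis using \<open>a \<le> b\<close> by simp
  qed
  have N0: "0 \<le> ?I a b ?N" by (intro integral_nonneg_AE) (simp add: Lp_norm_2_nonneg)
  have "\<bar>?E b - ?E a - ?I a b ?H\<bar> \<le> 0 + e" if e: "0 < e" for e
  proof -
    have "\<bar>?E b - ?E a - ?I a b ?H\<bar> \<le> e / (?I a b ?N + 1) * ?I a b ?N"
      using N0 e by (intro main) simp
    also have "\<dots> \<le> e" using N0 e by (simp add: field_simps)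
    finally show ?thesis by simp
  qed
  then have "\<bar>?E b - ?E a - ?I a b ?H\<bar> \<le> 0" by (rule field_le_epsilon)
  then show ?thesis by simp
qed

text \<open>
  The definition of the time derivative integrates from the left endpoint only; subtraction gives
  all inner intervals.
\<close>

lemma has_time_deriv_weak:
  assumes u: "has_time_deriv \<nu> a b u u'" and "a \<le> s" "s < t" "t < b" and \<phi>: "\<phi> \<in> Lp_space \<nu> 2"
  shows "has_bochner_integral (lebesgue_on {s<..<t}) (\<lambda>r. L2_inner \<nu> (u' r) \<phi>)
    (L2_inner \<nu> (\<lambda>x. u t x - u s x) \<phi>)"
proof -
  let ?f = "\<lambda>r. L2_inner \<nu> (u' r) \<phi>"
  have base: "has_bochner_integral (lebesgue_on {a<..<r}) ?f (L2_inner \<nu> (\<lambda>x. u r x - u a x) \<phi>)"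
    and mem: "(\<lambda>x. u r x - u a x) \<in> Lp_space \<nu> 2" if "a < r" "r < b" for r
  proof -
    have *: "has_L2_integral \<nu> u' (\<lambda>x. u r x - u a x) {a<..<r}"
      using u that by (simp add: has_time_deriv_def)
    then show "(\<lambda>x. u r x - u a x) \<in> Lp_space \<nu> 2" by (simp add: has_L2_integral_def)
    show "has_bochner_integral (lebesgue_on {a<..<r}) ?f (L2_inner \<nu> (\<lambda>x. u r x - u a x) \<phi>)"
      using that by (intro has_L2_integral_inner[OF * _ _ \<phi>]) simp_all
  qed
  show ?thesis
  proof (cases "s = a")
    case True
    then show ?thesis using base[of t] assms(2-4) by simp
  next
    case False
    then have as: "a < s" using assms(2) by simp
    have i: "integrable (lebesgue_on {a<..<t}) ?f"
      using base[of t] as assms(3,4) by (simp add: has_bochner_integral_iff)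
    have "(LINT r|lebesgue_on {a<..<t}. ?f r)
        = (LINT r|lebesgue_on {a<..<s}. ?f r) + (LINT r|lebesgue_on {s<..<t}. ?f r)"
      using as assms(3) by (intro integral_Ioo_combine i) simp_all
    moreover have "L2_inner \<nu> (\<lambda>x. (u t x - u a x) - (u s x - u a x)) \<phi>
        = L2_inner \<nu> (\<lambda>x. u t x - u a x) \<phi> - L2_inner \<nu> (\<lambda>x. u s x - u a x) \<phi>"
      using mem[of s] mem[of t] as assms(3,4) \<phi> by (intro L2_inner_diff_left) simp_all
    moreover have "integrable (lebesgue_on {s<..<t}) ?f"
      by (rule integrable_lebesgue_on_subset[OF i]) (use as in auto)
    ultimately show ?thesis
      using base[of s] base[of t] as assms(3,4) by (simp add: has_bochner_integral_iff)
  qed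
qed

lemma has_time_deriv_norm_integrable:
  assumes u: "has_time_deriv \<nu> a0 b0 u u'" and "a0 \<le> a" "b \<le> b0"
  shows "strongly_measurable (Lp_space \<nu> 2) (Lp_norm \<nu> 2) {a<..<b} u'"
    and "integrable (lebesgue_on {a<..<b}) (\<lambda>t. Lp_norm \<nu> 2 (u' t))"
proof -
  have L: "u' \<in> L2_L2 \<nu> a0 b0" using u by (simp add: has_time_deriv_def)
  have sm: "strongly_measurable (Lp_space \<nu> 2) (Lp_norm \<nu> 2) {a0<..<b0} u'"
    using L by (simp add: bochner_Lq_def)
  show "strongly_measurable (Lp_space \<nu> 2) (Lp_norm \<nu> 2) {a<..<b} u'"
    by (rule strongly_measurable_subset[OF sm]) (use assms in auto)
  show "integrable (lebesgue_on {a<..<b}) (\<lambda>t. Lp_norm \<nu> 2 (u' t))"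
    by (rule integrable_lebesgue_on_subset[OF L2_L2_norm_integrable[OF L]]) (use assms in auto)
qed

text \<open>
  The energy identity for \<open>w = v - u\<close>. The two derivatives may be given on different larger
  intervals: for a weak solution, \<open>u'\<close> is available only on compact subintervals of \<open>(0, T)\<close>.
  The condition that \<open>b\<close> lies strictly inside them is needed because \<open>has_time_deriv\<close> says nothing
  about the right endpoint.
\<close>

lemma energy_identity_diff:
  assumes "a \<le> b" "b < b1" "b < b2"
    and vc: "L2_continuous_on \<nu> {a..b} v" and vd: "has_time_deriv \<nu> a1 b1 v v'" "a1 \<le> a"
    and uc: "L2_continuous_on \<nu> {a..b} u" and ud: "has_time_deriv \<nu> a2 b2 u u'" "a2 \<le> a"
  defines "w \<equiv> \<lambda>t x. v t x - u t x"
  shows "integrable (lebesgue_on {a<..<b}) (\<lambda>t. L2_inner \<nu> (v' t) (w t))" (is ?iv)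
    and "integrable (lebesgue_on {a<..<b}) (\<lambda>t. L2_inner \<nu> (u' t) (w t))" (is ?iu)
    and "(LINT t|lebesgue_on {a<..<b}. L2_inner \<nu> (v' t) (w t))
        - (LINT t|lebesgue_on {a<..<b}. L2_inner \<nu> (u' t) (w t))
      = 1 / 2 * (Lp_norm \<nu> 2 (w b))\<^sup>2 - 1 / 2 * (Lp_norm \<nu> 2 (w a))\<^sup>2"
proof -
  let ?w' = "\<lambda>t x. v' t x - u' t x"
  note v' = has_time_deriv_norm_integrable[OF vd less_imp_le[OF \<open>b < b1\<close>]]
  note u' = has_time_deriv_norm_integrable[OF ud less_imp_le[OF \<open>b < b2\<close>]]
  have wc: "L2_continuous_on \<nu> {a..b} w" unfolding w_def by (rule L2_continuous_on_diff[OF vc uc])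
  show iv: ?iv by (rule L2_inner_integrable[OF v' wc])
  show iu: ?iu by (rule L2_inner_integrable[OF u' wc])
  have w': "strongly_measurable (Lp_space \<nu> 2) (Lp_norm \<nu> 2) {a<..<b} ?w'"
    by (rule strongly_measurable_diff[OF v'(1) u'(1)]) simp
  have mem: "AE t in lebesgue_on {a<..<b}. v' t \<in> Lp_space \<nu> 2 \<and> u' t \<in> Lp_space \<nu> 2"
    using strongly_measurable_AE_mem[OF v'(1)] strongly_measurable_AE_mem[OF u'(1)] by eventually_elim simp
  have w'i: "integrable (lebesgue_on {a<..<b}) (\<lambda>t. Lp_norm \<nu> 2 (?w' t))"
  proof (rule Bochner_Integration.integrable_bound[OF Bochner_Integration.integrable_add[OF v'(2) u'(2)]])
    show "(\<lambda>t. Lp_norm \<nu> 2 (?w' t)) \<in> borel_measurable (lebesgue_on {a<..<b})"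
      by (rule Lp_norm_2_measurable[OF w']) simp
    show "AE t in lebesgue_on {a<..<b}. norm (Lp_norm \<nu> 2 (?w' t)) \<le> norm (Lp_norm \<nu> 2 (v' t) + Lp_norm \<nu> 2 (u' t))"
      using mem by eventually_elim (simp add: Lp_norm_2_nonneg Lp_norm_2_diff_le)
  qed
  have weak: "has_bochner_integral (lebesgue_on {s<..<t}) (\<lambda>r. L2_inner \<nu> (?w' r) \<phi>)
      (L2_inner \<nu> (\<lambda>x. w t x - w s x) \<phi>)"
    if st: "a \<le> s" "s < t" "t \<le> b" and \<phi>: "\<phi> \<in> Lp_space \<nu> 2" for s t \<phi>
  proof -
    have V: "has_bochner_integral (lebesgue_on {s<..<t}) (\<lambda>r. L2_inner \<nu> (v' r) \<phi>)
        (L2_inner \<nu> (\<lambda>x. v t x - v s x) \<phi>)"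
      using st assms by (intro has_time_deriv_weak[OF vd(1) _ _ _ \<phi>]) auto
    have U: "has_bochner_integral (lebesgue_on {s<..<t}) (\<lambda>r. L2_inner \<nu> (u' r) \<phi>)
        (L2_inner \<nu> (\<lambda>x. u t x - u s x) \<phi>)"
      using st assms by (intro has_time_deriv_weak[OF ud(1) _ _ _ \<phi>]) auto
    have memt: "v r \<in> Lp_space \<nu> 2" "u r \<in> Lp_space \<nu> 2" if "r \<in> {a..b}" for r
      using vc uc that by (auto simp: L2_continuous_on_def)
    have "L2_inner \<nu> (\<lambda>x. (v t x - v s x) - (u t x - u s x)) \<phi>
        = L2_inner \<nu> (\<lambda>x. v t x - v s x) \<phi> - L2_inner \<nu> (\<lambda>x. u t x - u s x) \<phi>"
      using memt[of s] memt[of t] st by (intro L2_inner_diff_left L2_diff \<phi>) auto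
    moreover have "(\<lambda>x. w t x - w s x) = (\<lambda>x. (v t x - v s x) - (u t x - u s x))"
      by (auto simp: w_def)
    ultimately have val: "L2_inner \<nu> (\<lambda>x. w t x - w s x) \<phi>
        = L2_inner \<nu> (\<lambda>x. v t x - v s x) \<phi> - L2_inner \<nu> (\<lambda>x. u t x - u s x) \<phi>" by simp
    have w'st: "strongly_measurable (Lp_space \<nu> 2) (Lp_norm \<nu> 2) {s<..<t} ?w'"
      by (rule strongly_measurable_subset[OF w']) (use st in auto)
    have m: "(\<lambda>r. L2_inner \<nu> (?w' r) \<phi>) \<in> borel_measurable (lebesgue_on {s<..<t})"
      by (intro L2_inner_measurable w'st strongly_measurable_const \<phi>) simp_all
    have ae: "AE r in lebesgue_on {s<..<t}. L2_inner \<nu> (v' r) \<phi> - L2_inner \<nu> (u' r) \<phi> = L2_inner \<nu> (?w' r) \<phi>"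
    proof -
      have "AE r in lebesgue_on {s<..<t}. v' r \<in> Lp_space \<nu> 2 \<and> u' r \<in> Lp_space \<nu> 2"
        by (rule AE_lebesgue_on_subset[OF mem]) (use st in auto)
      then show ?thesis by eventually_elim (simp add: L2_inner_diff_left \<phi>)
    qed
    have D: "has_bochner_integral (lebesgue_on {s<..<t}) (\<lambda>r. L2_inner \<nu> (v' r) \<phi> - L2_inner \<nu> (u' r) \<phi>)
        (L2_inner \<nu> (\<lambda>x. w t x - w s x) \<phi>)"
      unfolding val by (rule has_bochner_integral_diff[OF V U])
    show ?thesis
      using has_bochner_integral_cong_AE[OF _ m ae] D by (auto simp: has_bochner_integral_iff)
  qed
  have "(LINT t|lebesgue_on {a<..<b}. L2_inner \<nu> (v' t) (w t))
      - (LINT t|lebesgue_on {a<..<b}. L2_inner \<nu> (u' t) (w t))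
      = (LINT t|lebesgue_on {a<..<b}. L2_inner \<nu> (v' t) (w t) - L2_inner \<nu> (u' t) (w t))"
    using iv iu by simp
  also have "\<dots> = (LINT t|lebesgue_on {a<..<b}. L2_inner \<nu> (?w' t) (w t))"
  proof (rule integral_cong_AE)
    show "(\<lambda>t. L2_inner \<nu> (v' t) (w t) - L2_inner \<nu> (u' t) (w t)) \<in> borel_measurable (lebesgue_on {a<..<b})"
      using iv iu by auto
    show "(\<lambda>t. L2_inner \<nu> (?w' t) (w t)) \<in> borel_measurable (lebesgue_on {a<..<b})"
      by (intro L2_inner_measurable w' L2_continuous_on_strongly_measurable wc) simp
    show "AE t in lebesgue_on {a<..<b}. L2_inner \<nu> (v' t) (w t) - L2_inner \<nu> (u' t) (w t) = L2_inner \<nu> (?w' t) (w t)"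
      using mem AE_space
    proof eventually_elim
      case (elim t)
      then have "w t \<in> Lp_space \<nu> 2" using wc by (simp add: L2_continuous_on_def)
      then show ?case using elim by (simp add: L2_inner_diff_left)
    qed
  qed
  also have "\<dots> = 1 / 2 * (Lp_norm \<nu> 2 (w b))\<^sup>2 - 1 / 2 * (Lp_norm \<nu> 2 (w a))\<^sup>2"
    by (rule energy_identity[OF \<open>a \<le> b\<close> wc w' w'i weak])
  finally show "(LINT t|lebesgue_on {a<..<b}. L2_inner \<nu> (v' t) (w t))
        - (LINT t|lebesgue_on {a<..<b}. L2_inner \<nu> (u' t) (w t))
      = 1 / 2 * (Lp_norm \<nu> 2 (w b))\<^sup>2 - 1 / 2 * (Lp_norm \<nu> 2 (w a))\<^sup>2" .
qed

section \<open>Semicontinuity and the subdifferential\<close>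

text \<open>
  Along a continuous path a lower semicontinuous functional is lower semicontinuous in time, so its
  strict superlevel sets are relatively open.
\<close>

lemma L2_lsc_measurable:
  assumes lsc: "L2_lsc \<nu> \<Phi>" and w: "L2_continuous_on \<nu> {a..b} w"
  shows "(\<lambda>t. \<Phi> (w t)) \<in> borel_measurable (lebesgue_on {a..b})"
proof (rule borel_measurableI_greater)
  fix c :: ennreal
  let ?A = "{t \<in> {a..b}. c < \<Phi> (w t)}"
  have "openin (top_of_set {a..b}) ?A"
    unfolding openin_euclidean_subtopology_iff
  proof (intro conjI ballI)
    show "?A \<subseteq> {a..b}" by auto
    fix t assume t: "t \<in> ?A"
    then have wt: "w t \<in> Lp_space \<nu> 2" using w by (simp add: L2_continuous_on_def)
    then obtain \<delta> where \<delta>: "0 < \<delta>"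
      "\<And>z. z \<in> Lp_space \<nu> 2 \<Longrightarrow> Lp_norm \<nu> 2 (\<lambda>x. z x - w t x) < \<delta> \<Longrightarrow> c < \<Phi> z"
      using lsc t unfolding L2_lsc_def by blast
    have "\<forall>\<^sub>F s in at t within {a..b}. Lp_norm \<nu> 2 (\<lambda>x. w s x - w t x) < \<delta>"
      using w t \<delta>(1) by (intro order_tendstoD(2)[where y=0]) (auto simp: L2_continuous_on_def)
    then obtain d where d: "0 < d" "\<And>s. s \<in> {a..b} \<Longrightarrow> s \<noteq> t \<Longrightarrow> dist s t < d \<Longrightarrow>
        Lp_norm \<nu> 2 (\<lambda>x. w s x - w t x) < \<delta>"
      unfolding eventually_at by blast
    have "s \<in> ?A" if s: "s \<in> {a..b}" "dist s t < d" for s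
    proof -
      have "Lp_norm \<nu> 2 (\<lambda>x. w s x - w t x) < \<delta>"
        using d(2)[OF s(1) _ s(2)] \<delta>(1) by (cases "s = t") auto
      then show ?thesis
        using \<delta>(2)[of "w s"] s(1) w by (simp add: L2_continuous_on_def)
    qed
    then show "\<exists>e>0. \<forall>x'\<in>{a..b}. dist x' t < e \<longrightarrow> x' \<in> ?A" using d(1) by blast
  qed
  then obtain U where "open U" "?A = {a..b} \<inter> U" by (auto simp: openin_open)
  then have "?A \<in> sets lebesgue" by simp
  moreover have "?A \<subseteq> {a..b}" by auto
  ultimately show "{t \<in> space (lebesgue_on {a..b}). c < \<Phi> (w t)} \<in> sets (lebesgue_on {a..b})"
    by (simp add: sets_restrict_space_iff)
qed

text \<open>
  The subgradient inequality for \<open>-u'\<close> in real numbers; finiteness of \<open>\<Phi>\<close> at both points removes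
  the extended arithmetic.
\<close>

lemma L2_subdiff_inequality:
  assumes sub: "(\<lambda>x. - u' x) \<in> L2_subdiff \<nu> \<Phi> u" and "u \<in> Lp_space \<nu> 2" "v \<in> Lp_space \<nu> 2"
    and fin: "\<Phi> v < \<infinity>"
  shows "\<Phi> u < \<infinity>"
    and "enn2real (\<Phi> u) \<le> enn2real (\<Phi> v) + L2_inner \<nu> u' (\<lambda>x. v x - u x)"
proof -
  have "\<Phi> u \<noteq> \<infinity>" using sub by (simp add: L2_subdiff_def)
  then show u: "\<Phi> u < \<infinity>" by (simp add: less_top)
  have "(\<lambda>x. v x - u x) \<in> Lp_space \<nu> 2" using assms by (intro L2_diff)
  then have "enn2ereal (\<Phi> (\<lambda>x. u x + (v x - u x))) - enn2ereal (\<Phi> u)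
      \<ge> ereal (L2_inner \<nu> (\<lambda>x. v x - u x) (\<lambda>x. - u' x))"
    using sub by (auto simp: L2_subdiff_def)
  moreover have "enn2ereal (\<Phi> v) = ereal (enn2real (\<Phi> v))"
    using fin by (cases "\<Phi> v") auto
  moreover have "enn2ereal (\<Phi> u) = ereal (enn2real (\<Phi> u))"
    using u by (cases "\<Phi> u") auto
  moreover have "L2_inner \<nu> (\<lambda>x. v x - u x) (\<lambda>x. - u' x) = - L2_inner \<nu> u' (\<lambda>x. v x - u x)"
    by (simp add: L2_inner_def mult.commute)
  ultimately show "enn2real (\<Phi> u) \<le> enn2real (\<Phi> v) + L2_inner \<nu> u' (\<lambda>x. v x - u x)"
    by simp
qed

text \<open>
  Integrating the subgradient inequality \<open>\<Phi>(u) \<le> \<Phi>(v) + \<langle>u', v - u\<rangle>\<close> and eliminating \<open>u'\<close> with the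
  energy identity. The right-hand side \<open>J\<close> no longer contains \<open>u'\<close>, so it stays controlled when
  the interval grows to \<open>(0, T)\<close>.
\<close>

lemma subdiff_interval_inequality:
  assumes ab: "a \<le> b" "b < b1" "b < b2"
    and vc: "L2_continuous_on \<nu> {a..b} v" and vd: "has_time_deriv \<nu> a1 b1 v v'" "a1 \<le> a"
    and uc: "L2_continuous_on \<nu> {a..b} u" and ud: "has_time_deriv \<nu> a2 b2 u u'" "a2 \<le> a"
    and sub: "AE t in lebesgue_on {a<..<b}. (\<lambda>x. - u' t x) \<in> L2_subdiff \<nu> \<Phi> (u t)"
    and fin: "AE t in lebesgue_on {a<..<b}. \<Phi> (v t) < \<infinity>"
    and Fi: "integrable (lebesgue_on {a<..<b}) (\<lambda>t. enn2real (\<Phi> (v t)))"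
  defines "w \<equiv> \<lambda>t x. v t x - u t x"
  defines "J \<equiv> (LINT t|lebesgue_on {a<..<b}. L2_inner \<nu> (v' t) (w t))
      + (LINT t|lebesgue_on {a<..<b}. enn2real (\<Phi> (v t)))
      - 1 / 2 * (Lp_norm \<nu> 2 (w b))\<^sup>2 + 1 / 2 * (Lp_norm \<nu> 2 (w a))\<^sup>2"
  shows "0 \<le> J" and "(\<integral>\<^sup>+ t. \<Phi> (u t) \<partial>lebesgue_on {a<..<b}) \<le> ennreal J"
proof -
  let ?M = "lebesgue_on {a<..<b}"
  let ?R = "\<lambda>t. enn2real (\<Phi> (v t)) + L2_inner \<nu> (u' t) (w t)"
  note E = energy_identity_diff[OF ab vc vd uc ud]
  have Ri: "integrable ?M ?R"
    unfolding w_def by (rule Bochner_Integration.integrable_add[OF Fi E(2)])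
  have JR: "J = (LINT t|?M. ?R t)"
    unfolding J_def w_def Bochner_Integration.integral_add[OF Fi E(2)] using E(3) by linarith
  have ae: "AE t in ?M. 0 \<le> ?R t \<and> \<Phi> (u t) \<le> ennreal (?R t)"
    using sub fin AE_space
  proof eventually_elim
    case (elim t)
    then have mem: "u t \<in> Lp_space \<nu> 2" "v t \<in> Lp_space \<nu> 2"
      using uc vc by (auto simp: L2_continuous_on_def)
    note * = L2_subdiff_inequality[where u = "u t" and v = "v t" and u' = "u' t", OF elim(1) mem elim(2)]
    have "\<Phi> (u t) = ennreal (enn2real (\<Phi> (u t)))" using *(1) by (simp add: less_top)
    also have "\<dots> \<le> ennreal (?R t)" using *(2) by (intro ennreal_leI) (simp add: w_def)
    finally have "\<Phi> (u t) \<le> ennreal (?R t)" .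
    moreover have "0 \<le> ?R t"
      using *(2) enn2real_nonneg[of "\<Phi> (u t)"] unfolding w_def by linarith
    ultimately show ?case by simp
  qed
  have R0: "AE t in ?M. 0 \<le> ?R t" using ae by eventually_elim simp
  show "0 \<le> J" unfolding JR by (rule integral_nonneg_AE[OF R0])
  have "(\<integral>\<^sup>+ t. \<Phi> (u t) \<partial>?M) \<le> (\<integral>\<^sup>+ t. ennreal (?R t) \<partial>?M)"
    by (rule nn_integral_mono_AE) (use ae in eventually_elim, simp)
  also have "\<dots> = ennreal J" unfolding JR by (rule nn_integral_eq_integral[OF Ri R0])
  finally show "(\<integral>\<^sup>+ t. \<Phi> (u t) \<partial>?M) \<le> ennreal J" .
qed

section \<open>Exhausting the time interval\<close>

lemma integral_exhaust_Ioo: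
  fixes f :: "real \<Rightarrow> real"
  assumes f: "integrable (lebesgue_on {0<..<T}) f"
    and a: "\<And>n. 0 < a n" "a \<longlonglongrightarrow> 0" and b: "\<And>n. b n < T" "b \<longlonglongrightarrow> T"
  shows "(\<lambda>n. LINT t|lebesgue_on {a n<..<b n}. f t) \<longlonglongrightarrow> (LINT t|lebesgue_on {0<..<T}. f t)"
proof -
  have F: "integrable lebesgue (\<lambda>t. indicator {0<..<T} t *\<^sub>R f t)"
    using f by (simp add: integrable_restrict_space)
  have "(\<lambda>n. LINT t|lebesgue. indicator {a n<..<b n} t *\<^sub>R f t)
      \<longlonglongrightarrow> (LINT t|lebesgue. indicator {0<..<T} t *\<^sub>R f t)"
  proof (rule integral_dominated_convergence[where w="\<lambda>t. norm (indicator {0<..<T} t *\<^sub>R f t)"])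
    show "integrable lebesgue (\<lambda>t. norm (indicator {0<..<T} t *\<^sub>R f t))" using F by (rule integrable_norm)
    show "(\<lambda>t. indicator {0<..<T} t *\<^sub>R f t) \<in> borel_measurable lebesgue" using F by auto
    show "(\<lambda>t. indicator {a n<..<b n} t *\<^sub>R f t) \<in> borel_measurable lebesgue" for n
    proof -
      have "integrable (lebesgue_on {a n<..<b n}) f"
      proof (rule integrable_lebesgue_on_subset[OF f])
        show "{a n<..<b n} \<subseteq> {0<..<T}" using a(1)[of n] b(1)[of n] by auto
      qed simp_all
      then show ?thesis by (auto simp: integrable_restrict_space)
    qed
    show "AE t in lebesgue. norm (indicator {a n<..<b n} t *\<^sub>R f t) \<le> norm (indicator {0<..<T} t *\<^sub>R f t)" for n
      using a(1)[of n] b(1)[of n] by (intro AE_I2) (auto simp: indicator_def)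
    have "(\<lambda>n. indicator {a n<..<b n} t *\<^sub>R f t) \<longlonglongrightarrow> indicator {0<..<T} t *\<^sub>R f t" for t
    proof (cases "t \<in> {0<..<T}")
      case True
      have "\<forall>\<^sub>F n in sequentially. a n < t" "\<forall>\<^sub>F n in sequentially. t < b n"
        using True by (auto intro: order_tendstoD a(2) b(2))
      then have "\<forall>\<^sub>F n in sequentially. indicator {a n<..<b n} t *\<^sub>R f t = indicator {0<..<T} t *\<^sub>R f t"
        by eventually_elim (use True in simp)
      then show ?thesis by (rule tendsto_eventually)
    next
      case False
      then have zero: "indicator {a n<..<b n} t *\<^sub>R f t = 0" for n
        using a(1)[of n] b(1)[of n] by (auto simp: indicator_def)
      show ?thesis unfolding zero using False by simp
    qed
    then show "AE t in lebesgue. (\<lambda>n. indicator {a n<..<b n} t *\<^sub>R f t) \<longlonglongrightarrow> indicator {0<..<T} t *\<^sub>R f t"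
      by simp
  qed
  then show ?thesis by (simp add: integral_restrict_space)
qed

lemma nn_integral_exhaust_Ioo:
  fixes f :: "real \<Rightarrow> ennreal"
  assumes f: "f \<in> borel_measurable (lebesgue_on {0<..<T})"
    and a: "\<And>n. 0 < a n" "a \<longlonglongrightarrow> 0" "decseq a" and b: "\<And>n. b n < T" "b \<longlonglongrightarrow> T" "incseq b"
  shows "(\<lambda>n. \<integral>\<^sup>+ t. f t \<partial>lebesgue_on {a n<..<b n}) \<longlonglongrightarrow> (\<integral>\<^sup>+ t. f t \<partial>lebesgue_on {0<..<T})"
proof -
  have "(\<lambda>n. \<integral>\<^sup>+ t. f t * indicator {a n<..<b n} t \<partial>lebesgue)
      \<longlonglongrightarrow> (\<integral>\<^sup>+ t. f t * indicator {0<..<T} t \<partial>lebesgue)"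
  proof (rule nn_integral_LIMSEQ)
    show "incseq (\<lambda>n t. f t * indicator {a n<..<b n} t)"
    proof (rule incseq_SucI, rule le_funI)
      fix n t
      have "{a n<..<b n} \<subseteq> {a (Suc n)<..<b (Suc n)}"
        using decseq_SucD[OF a(3), of n] incseq_SucD[OF b(3), of n] by auto
      then show "f t * indicator {a n<..<b n} t \<le> f t * indicator {a (Suc n)<..<b (Suc n)} t"
        by (intro mult_left_mono) (auto simp: indicator_def)
    qed
    show "(\<lambda>t. f t * indicator {a n<..<b n} t) \<in> borel_measurable lebesgue" for n
    proof -
      have "{a n<..<b n} \<subseteq> {0<..<T}" using a(1)[of n] b(1)[of n] by auto
      from measurable_restrict_mono[OF f this] show ?thesis
        by (simp add: borel_measurable_restrict_space_iff_ennreal)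
    qed
    fix t
    show "(\<lambda>n. f t * indicator {a n<..<b n} t) \<longlonglongrightarrow> f t * indicator {0<..<T} t"
    proof (cases "t \<in> {0<..<T}")
      case True
      have "\<forall>\<^sub>F n in sequentially. a n < t" "\<forall>\<^sub>F n in sequentially. t < b n"
        using True by (auto intro: order_tendstoD a(2) b(2))
      then have "\<forall>\<^sub>F n in sequentially. f t * indicator {a n<..<b n} t = f t * indicator {0<..<T} t"
        by eventually_elim (use True in simp)
      then show ?thesis by (rule tendsto_eventually)
    next
      case False
      then have zero: "f t * indicator {a n<..<b n} t = 0" for n
        using a(1)[of n] b(1)[of n] by (auto simp: indicator_def)
      show ?thesis unfolding zero using False by simp
    qed
  qed
  then show ?thesis by (simp add: nn_integral_restrict_space)
qed

section \<open>The variational inequality\<close>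

text \<open>
  The inequality on \<open>[a, b]\<close> with \<open>a \<rightarrow> 0\<close> and \<open>b \<rightarrow> T\<close>: the left-hand side converges by monotone
  convergence, the terms of \<open>J\<close> by dominated convergence and by continuity of the paths. The energy
  of \<open>u\<close> appears alone on the left, so that its finiteness is a conclusion.
\<close>

lemma weak_solution_variational_inequality:
  assumes lsc: "L2_lsc \<nu> \<Phi>" and "0 < T" and u0: "u0 \<in> Lp_space \<nu> 2"
    and sol: "weak_solution \<nu> T \<Phi> u0 u"
    and vc: "L2_continuous_on \<nu> {0..T} v" and vd: "has_time_deriv \<nu> 0 T v v'"
    and fin: "(\<integral>\<^sup>+ t. \<Phi> (v t) \<partial>lebesgue_on {0..T}) < \<infinity>"
  defines "J \<equiv> (LINT t|lebesgue_on {0..T}. L2_inner \<nu> (v' t) (\<lambda>x. v t x - u t x))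
      + enn2real (\<integral>\<^sup>+ t. \<Phi> (v t) \<partial>lebesgue_on {0..T})
      - 1 / 2 * (Lp_norm \<nu> 2 (\<lambda>x. v T x - u T x))\<^sup>2 + 1 / 2 * (Lp_norm \<nu> 2 (\<lambda>x. v 0 x - u0 x))\<^sup>2"
  shows "0 \<le> J" and "(\<integral>\<^sup>+ t. \<Phi> (u t) \<partial>lebesgue_on {0..T}) \<le> ennreal J"
proof -
  obtain u' where uc: "L2_continuous_on \<nu> {0..T} u" and ini: "AE x in \<nu>. u 0 x = u0 x"
    and ud: "\<And>a b. 0 < a \<Longrightarrow> a < b \<Longrightarrow> b < T \<Longrightarrow> has_time_deriv \<nu> a b u u'"
    and sub: "AE t in lebesgue_on {0<..<T}. (\<lambda>x. - u' t x) \<in> L2_subdiff \<nu> \<Phi> (u t)"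
    using sol unfolding weak_solution_def by blast
  let ?M = "lebesgue_on {0<..<T}"
  let ?F = "\<lambda>t. enn2real (\<Phi> (v t))"
  define w where "w = (\<lambda>t x. v t x - u t x)"
  have wc: "L2_continuous_on \<nu> {0..T} w" unfolding w_def by (rule L2_continuous_on_diff[OF vc uc])
  have restr: "{0<..<T} \<subseteq> {0..T}" by auto
  have mv: "(\<lambda>t. \<Phi> (v t)) \<in> borel_measurable ?M" and mu: "(\<lambda>t. \<Phi> (u t)) \<in> borel_measurable ?M"
    by (rule measurable_restrict_mono[OF L2_lsc_measurable[OF lsc vc] restr],
        rule measurable_restrict_mono[OF L2_lsc_measurable[OF lsc uc] restr])
  have fin': "(\<integral>\<^sup>+ t. \<Phi> (v t) \<partial>?M) < \<infinity>" using fin by (simp add: nn_integral_Ioo_eq_Icc)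
  have aefin: "AE t in ?M. \<Phi> (v t) < \<infinity>"
    using nn_integral_PInf_AE[OF mv] fin' by (simp add: less_top)
  have FF: "(\<integral>\<^sup>+ t. ennreal (?F t) \<partial>?M) = (\<integral>\<^sup>+ t. \<Phi> (v t) \<partial>?M)"
    by (rule nn_integral_cong_AE) (use aefin in eventually_elim, simp add: less_top)
  have Fi: "integrable ?M ?F"
    using mv fin' FF by (intro integrableI_nonneg) auto
  have Fval: "(LINT t|?M. ?F t) = enn2real (\<integral>\<^sup>+ t. \<Phi> (v t) \<partial>lebesgue_on {0..T})"
    unfolding nn_integral_Ioo_eq_Icc[symmetric] FF[symmetric]
    using Fi by (intro integral_eq_nn_integral) auto
  have Vi: "integrable ?M (\<lambda>t. L2_inner \<nu> (v' t) (w t))"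
    using has_time_deriv_norm_integrable[OF vd order_refl order_refl] wc by (rule L2_inner_integrable)
  \<comment> \<open>The shift by \<open>3\<close> keeps \<open>a n\<close> below \<open>T / 2\<close> and hence below \<open>b n\<close> from the start.\<close>
  define a where "a n = T / real (n + 3)" for n
  define b where "b n = T - a n" for n
  have a0: "0 < a n" and ab: "a n < b n" and bT: "b n < T" for n
  proof -
    have "a n < T / 2"
      unfolding a_def using \<open>0 < T\<close> by (intro divide_strict_left_mono) auto
    moreover show "0 < a n" unfolding a_def using \<open>0 < T\<close> by simp
    ultimately show "a n < b n" "b n < T" by (simp_all add: b_def)
  qed
  have lima: "a \<longlonglongrightarrow> 0"
    unfolding a_def by (rule LIMSEQ_ignore_initial_segment[OF lim_const_over_n])
  then have limb: "b \<longlonglongrightarrow> T" unfolding b_def by (auto intro: tendsto_eq_intros)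
  have dec: "decseq a"
    unfolding a_def using \<open>0 < T\<close> by (intro decseq_SucI divide_left_mono) auto
  then have inc: "incseq b" by (simp add: b_def monotone_on_def)
  let ?J = "\<lambda>n. (LINT t|lebesgue_on {a n<..<b n}. L2_inner \<nu> (v' t) (w t))
      + (LINT t|lebesgue_on {a n<..<b n}. ?F t)
      - 1 / 2 * (Lp_norm \<nu> 2 (w (b n)))\<^sup>2 + 1 / 2 * (Lp_norm \<nu> 2 (w (a n)))\<^sup>2"
  have step: "0 \<le> ?J n \<and> (\<integral>\<^sup>+ t. \<Phi> (u t) \<partial>lebesgue_on {a n<..<b n}) \<le> ennreal (?J n)" for n
  proof -
    \<comment> \<open>The derivative of \<open>u\<close> is taken on \<open>(a n, ?c)\<close>, which contains \<open>b n\<close> in its interior.\<close>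
    let ?c = "(b n + T) / 2"
    have c: "b n < ?c" "?c < T" using bT[of n] by auto
    have sub_n: "{a n<..<b n} \<subseteq> {0<..<T}" "{a n..b n} \<subseteq> {0..T}" using a0[of n] bT[of n] by auto
    note * = subdiff_interval_inequality[OF less_imp_le[OF ab[of n]] bT[of n] c(1)
      L2_continuous_on_subset[OF vc sub_n(2)] vd less_imp_le[OF a0[of n]]
      L2_continuous_on_subset[OF uc sub_n(2)] ud[OF a0[of n] less_trans[OF ab[of n] c(1)] c(2)] order_refl
      AE_lebesgue_on_subset[OF sub sub_n(1)] AE_lebesgue_on_subset[OF aefin sub_n(1)]
      integrable_lebesgue_on_subset[OF Fi sub_n(1)]]
    show ?thesis unfolding w_def by (intro conjI *) simp_all
  qed
  have norm_lim: "(\<lambda>n. Lp_norm \<nu> 2 (w (x n))) \<longlonglongrightarrow> Lp_norm \<nu> 2 (w y)"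
    if "x \<longlonglongrightarrow> y" "y \<in> {0..T}" "\<And>n. x n \<in> {0..T}" for x y
    by (rule continuous_on_tendsto_compose[OF L2_continuous_on_norm[OF wc] that(1,2)])
      (intro always_eventually allI that(3))
  have ab_in: "a n \<in> {0..T}" "b n \<in> {0..T}" for n using a0[of n] ab[of n] bT[of n] by auto
  have w0: "Lp_norm \<nu> 2 (w 0) = Lp_norm \<nu> 2 (\<lambda>x. v 0 x - u0 x)"
  proof (rule Lp_norm_2_cong_AE)
    have "v 0 \<in> borel_measurable \<nu>" "u 0 \<in> borel_measurable \<nu>" "u0 \<in> borel_measurable \<nu>"
      using vc uc u0 \<open>0 < T\<close> by (auto simp: L2_continuous_on_def Lp_space_def)
    then show "w 0 \<in> borel_measurable \<nu>" "(\<lambda>x. v 0 x - u0 x) \<in> borel_measurable \<nu>"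
      unfolding w_def by measurable
    show "AE x in \<nu>. w 0 x = v 0 x - u0 x" using ini by eventually_elim (simp add: w_def)
  qed
  have J: "J = (LINT t|?M. L2_inner \<nu> (v' t) (w t)) + (LINT t|?M. ?F t)
      - 1 / 2 * (Lp_norm \<nu> 2 (w T))\<^sup>2 + 1 / 2 * (Lp_norm \<nu> 2 (w 0))\<^sup>2"
    unfolding J_def Fval w0 integral_Ioo_eq_Icc(2)[OF Vi] by (simp add: w_def)
  have Jlim: "?J \<longlonglongrightarrow> J"
    unfolding J using \<open>0 < T\<close>
    by (intro tendsto_add tendsto_diff tendsto_mult tendsto_power tendsto_const norm_lim
        integral_exhaust_Ioo Vi Fi a0 lima bT limb ab_in) auto
  show "0 \<le> J" using step by (intro LIMSEQ_le_const[OF Jlim]) auto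
  have "(\<integral>\<^sup>+ t. \<Phi> (u t) \<partial>?M) \<le> ennreal J"
  proof (rule LIMSEQ_le)
    show "(\<lambda>n. \<integral>\<^sup>+ t. \<Phi> (u t) \<partial>lebesgue_on {a n<..<b n}) \<longlonglongrightarrow> (\<integral>\<^sup>+ t. \<Phi> (u t) \<partial>?M)"
      by (rule nn_integral_exhaust_Ioo[OF mu a0 lima dec bT limb inc])
    show "(\<lambda>n. ennreal (?J n)) \<longlonglongrightarrow> ennreal J" using Jlim by (rule tendsto_ennrealI)
    show "\<exists>N. \<forall>n\<ge>N. (\<integral>\<^sup>+ t. \<Phi> (u t) \<partial>lebesgue_on {a n<..<b n}) \<le> ennreal (?J n)"
      using step by blast
  qed
  then show "(\<integral>\<^sup>+ t. \<Phi> (u t) \<partial>lebesgue_on {0..T}) \<le> ennreal J" by (simp add: nn_integral_Ioo_eq_Icc)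
qed

lemma AE_lebesgue_on_Ioo_ex:
  assumes "AE t in lebesgue_on {a<..<b}. P t" "a < (b::real)"
  shows "\<exists>t\<in>{a<..<b}. P t"
proof (rule ccontr)
  assume "\<not> ?thesis"
  then have "AE t in lebesgue. t \<notin> {a<..<b}"
    using assms(1) by (auto simp: AE_lebesgue_on_iff elim!: eventually_mono)
  then have "{a<..<b} \<in> null_sets lebesgue" by (subst AE_iff_null_sets) auto
  then show False using assms(2) by (simp add: null_sets_def)
qed

lemma has_time_deriv_const:
  assumes z: "z \<in> Lp_space \<nu> 2"
  shows "has_time_deriv \<nu> a b (\<lambda>_. z) (\<lambda>_ _. 0)"
  unfolding has_time_deriv_def
proof (intro conjI ballI)
  have fin: "emeasure (lebesgue_on {a<..<b}) (space (lebesgue_on {a<..<b})) < \<infinity>"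
    by (cases "a \<le> b"; simp add: emeasure_restrict_space)
  have const: "(\<lambda>_. y) \<in> L2_L2 \<nu> a b" if "y \<in> Lp_space \<nu> 2" for y
    using strongly_measurable_const[OF that, of "{a<..<b}"] fin
    by (simp add: bochner_Lq_def ennreal_mult_less_top)
  show "(\<lambda>_. z) \<in> L2_L2 \<nu> a b" by (rule const[OF z])
  show "(\<lambda>_ _. 0) \<in> L2_L2 \<nu> a b" by (rule const[OF L2_zero])
  fix t
  have "simple_path (Lp_space \<nu> 2) {a<..<t} (\<lambda>_ _. 0)"
    by (auto simp: simple_path_iff L2_zero)
  moreover have "simple_path_integral {a<..<t} (\<lambda>_ _. 0) = (\<lambda>_::'a. 0)"
    by (rule ext) (auto simp: simple_path_integral_def intro!: sum.neutral)
  ultimately show "has_L2_integral \<nu> (\<lambda>_ _. 0) (\<lambda>x. z x - z x) {a<..<t}"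
    unfolding has_L2_integral_def
    using strongly_measurable_const[OF L2_zero, of "{a<..<t}" \<nu>]
    by (auto simp: L2_zero intro!: exI[of _ "\<lambda>_ _ _. 0"])
qed

text \<open>
  The competitor \<open>v\<close> is constant in time, equal to \<open>u(t)\<close> for one time \<open>t\<close> at which the subdifferential
  of \<open>\<Phi>\<close> at \<open>u(t)\<close> is nonempty; there \<open>\<Phi>(u(t))\<close> is finite.
\<close>

lemma weak_solution_energy_finite:
  assumes lsc: "L2_lsc \<nu> \<Phi>" and T: "0 < T" and u0: "u0 \<in> Lp_space \<nu> 2"
    and sol: "weak_solution \<nu> T \<Phi> u0 u"
  shows "(\<integral>\<^sup>+ t. \<Phi> (u t) \<partial>lebesgue_on {0..T}) < \<infinity>"
proof -
  obtain u' where uc: "L2_continuous_on \<nu> {0..T} u"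
    and sub: "AE t in lebesgue_on {0<..<T}. (\<lambda>x. - u' t x) \<in> L2_subdiff \<nu> \<Phi> (u t)"
    using sol unfolding weak_solution_def by blast
  obtain t where t: "t \<in> {0<..<T}" "(\<lambda>x. - u' t x) \<in> L2_subdiff \<nu> \<Phi> (u t)"
    using AE_lebesgue_on_Ioo_ex[OF sub T] by blast
  have z: "u t \<in> Lp_space \<nu> 2" using t(1) uc by (simp add: L2_continuous_on_def)
  have "\<Phi> (u t) \<noteq> \<infinity>" using t(2) by (simp add: L2_subdiff_def)
  then have fin: "(\<integral>\<^sup>+ s. \<Phi> (u t) \<partial>lebesgue_on {0..T}) < \<infinity>"
    using T by (simp add: emeasure_restrict_space ennreal_mult_less_top less_top)
  have "L2_continuous_on \<nu> {0..T} (\<lambda>_. u t)" using z by (simp add: L2_continuous_on_def)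
  from weak_solution_variational_inequality(2)[OF lsc T u0 sol this has_time_deriv_const[OF z] fin]
  show ?thesis by (rule le_less_trans) simp
qed

theorem proposition3p6:
  fixes \<nu> :: "'a::polish_space measure" and p T :: real
    and E :: "'a covector_field \<Rightarrow> real"
    and u0 :: "'a \<Rightarrow> real" and u v dv :: "real \<Rightarrow> 'a \<Rightarrow> real"
  assumes "radon_measure \<nu>" and "finite_on_bounded \<nu>" and "1 < p"
    and "cot_continuous \<nu> p E" and "cot_convex \<nu> p E"
    and "\<exists>C>0. \<forall>\<omega>\<in>cotangent \<nu> p. E \<omega> \<ge> C * (LINT x|\<nu>. cot_pointwise_norm \<nu> p \<omega> x powr p)"
    and "L2_convex \<nu> (grad_energy \<nu> p E)" and "L2_lsc \<nu> (grad_energy \<nu> p E)"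
    and "0 < T" and "u0 \<in> Lp_space \<nu> 2"
    and "weak_solution \<nu> T (grad_energy \<nu> p E) u0 u"
    and "v \<in> bochner_Lq 1 (sobolev \<nu> p) (sobolev_norm \<nu> p) {0<..<T}"
    and "L2_continuous_on \<nu> {0..T} v"
    and "has_time_deriv \<nu> 0 T v dv"
    and "(\<lambda>(x, t). dv t x) \<in> Lp_space (\<nu> \<Otimes>\<^sub>M lebesgue_on {0..T}) 2"
  shows "(\<integral>\<^sup>+ t. grad_energy \<nu> p E (u t) \<partial>lebesgue_on {0..T}) < \<infinity> \<and>
    ereal (LINT t|lebesgue_on {0..T}. LINT x|\<nu>. dv t x * (v t x - u t x))
      + enn2ereal (\<integral>\<^sup>+ t. grad_energy \<nu> p E (v t) \<partial>lebesgue_on {0..T})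
      - enn2ereal (\<integral>\<^sup>+ t. grad_energy \<nu> p E (u t) \<partial>lebesgue_on {0..T})
    \<ge> ereal (1 / 2 * (Lp_norm \<nu> 2 (\<lambda>x. v T x - u T x))\<^sup>2
             - 1 / 2 * (Lp_norm \<nu> 2 (\<lambda>x. v 0 x - u0 x))\<^sup>2)"
proof -
  let ?A = "\<integral>\<^sup>+ t. grad_energy \<nu> p E (u t) \<partial>lebesgue_on {0..T}"
  let ?B = "\<integral>\<^sup>+ t. grad_energy \<nu> p E (v t) \<partial>lebesgue_on {0..T}"
  have A: "?A < \<infinity>"
    by (rule weak_solution_energy_finite[OF assms(8-11)])
  then have eA: "enn2ereal ?A = ereal (enn2real ?A)"
    by (cases ?A) auto
  show ?thesis
  proof (cases "?B < \<infinity>")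
    case True
    then have eB: "enn2ereal ?B = ereal (enn2real ?B)"
      by (cases ?B) auto
    note * = weak_solution_variational_inequality[OF assms(8-11,13,14) True]
    from enn2real_mono[OF *(2)] have "enn2real ?A
      \<le> (LINT t|lebesgue_on {0..T}. L2_inner \<nu> (dv t) (\<lambda>x. v t x - u t x)) + enn2real ?B
      - 1 / 2 * (Lp_norm \<nu> 2 (\<lambda>x. v T x - u T x))\<^sup>2 + 1 / 2 * (Lp_norm \<nu> 2 (\<lambda>x. v 0 x - u0 x))\<^sup>2"
      using *(1) by simp
    then show ?thesis using A unfolding eA eB by (simp add: L2_inner_def)
  next
    case False
    then have "enn2ereal ?B = \<infinity>" by (simp add: less_top[symmetric])
    then show ?thesis using A unfolding eA by simp
  qed
qed

end
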